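(* Let $H$ be a Lie group with Lie algebra $\mathfrak h$, let $d\subset\mathfrak h$ be a linear subspace defining the left-invariant constraints distribution $D=H\times d\subset \mathrm{T}H\approx H\times\mathfrak h$, and let $\mathfrak h=d\oplus d'$ be a splitting into linear subspaces with projections $P:\mathfrak h\to d$, $P':\mathfrak h\to d'$. Assume that the smooth Lagrangian $L:H\times\mathfrak h\to\mathbb R$ is $H$-invariant. Then $\frac{\partial L}{\partial h}=0$ and thus, for an admissible curve $(h(t),\eta(t))\in H\times d$: (i) If $(h(t),\eta(t))$ is a nonholonomic extremal, it is an unconstrained extremal if and only if, for every $t$, $$\frac{\mathrm d}{\mathrm dt}\Big(\frac{\partial L}{\partial\eta}\Big)-\operatorname{ad}^*_{\eta(t)}\Big(\frac{\partial L}{\partial \eta}\Big)\in\operatorname{Ann}(d')\subset\mathfrak h^*.$$ (ii) If $(h(t),\eta(t))$ is a nonholonomic extremal, it is a vakonomic extremal if and only if $$\int_I\Big\langle\operatorname{ad}^*_{\eta(t)}P^*\Big(\frac{\partial L}{\partial\eta}\Big),b(t)\Big\rangle\mathrm dt=\int_I\Big\langle\operatorname{ad}^*_{\eta(t)}(P')^*\Big(\frac{\partial L}{\partial\eta}\Big),a(t)\Big\rangle\mathrm dt$$ for every pair $a(t)\in d$, $b(t)\in d'$ vanishing at the end-points and related by $\dot b(t)+P'[\eta(t),a(t)]_{\mathfrak h}+P'[\eta(t),b(t)]_{\mathfrak h}=0$. (iii) $(h(t),\eta(t))$ is a nonholonomic extremal if and only if, for every $t$, $$\frac{\mathrm d}{\mathrm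 dt}\Big(\frac{\partial L}{\partial\eta}\Big)-\operatorname{ad}^*_{\eta(t)}\Big(\frac{\partial L}{\partial \eta}\Big)\in\operatorname{Ann}(d)\subset\mathfrak h^*.$$ (iv) If $(h(t),\eta(t))$ is a vakonomic extremal associated with a multiplier $\lambda(t)\in\operatorname{Ann}(d)$, then, for every $t$, $$\frac{\mathrm d}{\mathrm dt}\Big(\frac{\partial L}{\partial\eta}-\lambda(t)\Big)-\operatorname{ad}^*_{\eta(t)}\Big(\frac{\partial L}{\partial \eta}-\lambda(t)\Big)\in\operatorname{Ann}(d')\subset\mathfrak h^*.$$
   Context: Everything is $C^\infty$; $I=[t_0,t_1]$ is a fixed interval. Variations. For a manifold $Q$, $\kappa_Q:\mathrm{TT}Q\to\mathrm{TT}Q$ is the canonical flip, $(q^a,\dot q^b,q'^c,\dot q'^d)\mapsto(q^a,q'^b,\dot q^c,\dot q'^d)$ in induced coordinates. If $\gamma(t)\in\mathrm TQ$ is the tangent lift of a curve $q(t)$ (an admissible path) and $\xi(t)\in\mathrm T_{q(t)}Q$ is a curve (generator), the admissible variation generated by $\xi$ is $\delta_\xi\gamma(t)=\kappa_Q(\mathrm T_t\xi(t))\in\mathrm T_{\gamma(t)}\mathrm TQ$, where $\mathrm T_t\xi(t)$ is the tangent lift of the curve $\xi$; and $\langle\mathrm dS_L(\gamma),\delta\gamma\rangle=\int_I\langle\mathrm dL(\gamma(t)),\delta\gamma(t)\rangle\mathrm dt$ (for a time-dependent Lagrangian, differentiate in the $\mathrm TQ$ variable). Lie group setting ($Q=H$).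 $\mathfrak h=\mathrm T_eH$ with the left Lie bracket $[\cdot,\cdot]_{\mathfrak h}$; $\mathrm TH\approx H\times\mathfrak h$ via $(h,\eta)\mapsto h_*\eta$ (left translation). $H$-invariance of $L$ is with respect to the left action of $H$, i.e. $L(gh,\eta)=L(h,\eta)$. A curve $(h(t),\eta(t))$ is admissible if $h(t)_*\eta(t)$ is the tangent lift of $h(t)$; generators are written as $\xi(t)\in\mathfrak h$ (standing for $h(t)_*\xi(t)$). An admissible curve with $\eta(t)\in d$ is: an unconstrained extremal if $\langle\mathrm dS_L,\delta_\xi\eta\rangle=0$ for all generators $\xi(t)\in\mathfrak h$ with $\xi(t_0)=\xi(t_1)=0$; a nonholonomic extremal if this holds for all such $\xi$ with $\xi(t)\in d$; a vakonomic extremal if this holds for all such $\xi$ for which the admissible variation is tangent to $D$ for all $t$; a vakonomic extremal associated with a multiplier $\lambda(t)=(P')^*\lambda(t)\in\operatorname{Ann}(d)$ if it is an unconstrained extremal for $\widetilde L(h,\eta,t)=L(h,\eta)-\langle\lambda(t),P'(\eta)\rangle$. Notation. $\frac{\partial L}{\partial h}\in\mathrm T_h^*H$ and $\frac{\partial L}{\partial\eta}\in\mathfrak h^*$ are the partial differentials of $L(h,\eta)$, evaluated at $(h(t),\eta(t))$; $\langle\operatorname{ad}^*_\eta\phi,\cdot\rangle=\langle\phi,[\eta,\cdot]_{\mathfrak h}\rangle$ for $\phi\in\mathfrak h^*$; $P^*,(P')^*$ are the dual maps, regarded as maps $\mathfrak h^*\to\mathfrak h^*$ by viewing $P,P'$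 as maps $\mathfrak h\to\mathfrak h$; $\operatorname{Ann}(\cdot)\subset\mathfrak h^*$ denotes the annihilator. *)

theory Defs
  imports "HOL-Analysis.Analysis"
begin

section \<open>Smooth maps between normed spaces\<close>

text \<open>
  \<open>times_differentiable_on k S f\<close>: all iterated directional derivatives of \<open>f\<close> up to order \<open>k\<close>
  exist and are continuous on \<open>S\<close>. It is only used where \<open>S\<close> is open in a finite-dimensional space or
  relatively open in an interval, where derivatives within \<open>S\<close> are unique; at an end-point of a
  closed interval they are one-sided.
\<close>

primrec times_differentiable_on ::
  "nat \<Rightarrow> 'a::real_normed_vector set \<Rightarrow> ('a \<Rightarrow> 'b::real_normed_vector) \<Rightarrow> bool" where
  "times_differentiable_on 0 S f \<longleftrightarrow> continuous_on S f"
| "times_differentiable_on (Suc k) S f \<longleftrightarrow>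
     (\<forall>x\<in>S. f differentiable (at x within S)) \<and>
     (\<forall>v. times_differentiable_on k S (\<lambda>x. frechet_derivative f (at x within S) v))"

definition smooth_on ::
  "'a::real_normed_vector set \<Rightarrow> ('a \<Rightarrow> 'b::real_normed_vector) \<Rightarrow> bool" where
  "smooth_on S f \<longleftrightarrow> (\<forall>k. times_differentiable_on k S f)"


section \<open>Manifolds\<close>

text \<open>
  A manifold on the type \<open>'m\<close> modelled on \<open>'e\<close> is presented by an atlas indexed by points:
  \<open>coord M p\<close>, with domain \<open>cdom M p\<close>, is a preferred chart around \<open>p\<close>. Every smooth structure
  arises in this way. The preferred charts let us represent the
  tangent space at \<open>p\<close> by \<open>'e\<close>: the pair \<open>(p, v)\<close> is the tangent vector at \<open>p\<close> whose
  coordinates in the chart \<open>coord M p\<close> are \<open>v\<close>.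
\<close>

record ('m, 'e) charted =
  cdom :: "'m \<Rightarrow> 'm set"
  coord :: "'m \<Rightarrow> 'm \<Rightarrow> 'e"

definition param :: "('m, 'e, 'z) charted_scheme \<Rightarrow> 'm \<Rightarrow> 'e \<Rightarrow> 'm" where
  "param M p = inv_into (cdom M p) (coord M p)"

definition manifold_topology ::
  "('m, 'e::real_normed_vector, 'z) charted_scheme \<Rightarrow> 'm topology" where
  "manifold_topology M = topology (\<lambda>U. \<forall>p. open (coord M p ` (U \<inter> cdom M p)))"

text \<open>
  The model space is only required to be a finite-dimensional inner product space; the class
  \<open>euclidean_space\<close> would exclude dimension zero.
\<close>

definition smooth_manifold :: "('m, 'e::real_inner, 'z) charted_scheme \<Rightarrow> bool" where
  "smooth_manifold M \<longleftrightarrow>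
     (\<exists>B::'e set. finite B \<and> span B = UNIV) \<and>
     (\<forall>p. p \<in> cdom M p \<and> inj_on (coord M p) (cdom M p)) \<and>
     (\<forall>p q. open (coord M p ` (cdom M p \<inter> cdom M q)) \<and>
        smooth_on (coord M p ` (cdom M p \<inter> cdom M q)) (coord M q \<circ> param M p)) \<and>
     Hausdorff_space (manifold_topology M) \<and>
     second_countable (manifold_topology M)"

definition vec_manifold :: "('v, 'v) charted" where
  "vec_manifold = \<lparr>cdom = \<lambda>_. UNIV, coord = \<lambda>_ v. v\<rparr>"

definition prod_manifold ::
  "('m, 'e, 'y) charted_scheme \<Rightarrow> ('n, 'f, 'z) charted_scheme \<Rightarrow> ('m \<times> 'n, 'e \<times> 'f) charted" where
  "prod_manifold M N =
     \<lparr>cdom = \<lambda>(p, q). cdom M p \<times> cdom N q,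
      coord = \<lambda>(p, q) (x, y). (coord M p x, coord N q y)\<rparr>"

text \<open>The openness requirements in the next two definitions express continuity.\<close>

definition smooth_map ::
  "('m, 'e::real_normed_vector, 'y) charted_scheme \<Rightarrow>
   ('n, 'f::real_normed_vector, 'z) charted_scheme \<Rightarrow> ('m \<Rightarrow> 'n) \<Rightarrow> bool" where
  "smooth_map M N f \<longleftrightarrow>
     (\<forall>p q. open (coord M p ` (cdom M p \<inter> f -` cdom N q)) \<and>
        smooth_on (coord M p ` (cdom M p \<inter> f -` cdom N q)) (coord N q \<circ> f \<circ> param M p))"

definition smooth_curve ::
  "('m, 'e::real_normed_vector, 'z) charted_scheme \<Rightarrow> real set \<Rightarrow> (real \<Rightarrow> 'm) \<Rightarrow> bool" where
  "smooth_curve M J c \<longleftrightarrow>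
     (\<forall>p. openin (top_of_set J) (J \<inter> c -` cdom M p) \<and>
        smooth_on (J \<inter> c -` cdom M p) (coord M p \<circ> c))"


section \<open>Tangent bundles\<close>

text \<open>
  The charts of the tangent bundle are those induced from the charts of \<open>M\<close>: a tangent vector
  \<open>(q, w)\<close>, given in the chart preferred at \<open>q\<close>, is converted by the derivative of the
  transition map into the chart preferred at \<open>p\<close>. The chart preferred at \<open>(p, v)\<close>
  is the one induced by the chart preferred at \<open>p\<close>.
\<close>

definition tangent_bundle ::
  "('m, 'e::real_normed_vector, 'z) charted_scheme \<Rightarrow> ('m \<times> 'e, 'e \<times> 'e) charted" where
  "tangent_bundle M =
     \<lparr>cdom = \<lambda>(p, v). cdom M p \<times> UNIV,
      coord = \<lambda>(p, v) (q, w).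
        (coord M p q, frechet_derivative (coord M p \<circ> param M q) (at (coord M q q)) w)\<rparr>"

definition tangent_map ::
  "('m, 'e::real_normed_vector, 'y) charted_scheme \<Rightarrow>
   ('n, 'f::real_normed_vector, 'z) charted_scheme \<Rightarrow> ('m \<Rightarrow> 'n) \<Rightarrow> 'm \<times> 'e \<Rightarrow> 'n \<times> 'f" where
  "tangent_map M N f = (\<lambda>(p, v).
     (f p, frechet_derivative (coord N (f p) \<circ> f \<circ> param M p) (at (coord M p p)) v))"

definition pairing ::
  "('m, 'e::real_normed_vector, 'z) charted_scheme \<Rightarrow> ('m \<Rightarrow> real) \<Rightarrow> 'm \<times> 'e \<Rightarrow> real" where
  "pairing M f = (\<lambda>(p, v). frechet_derivative (f \<circ> param M p) (at (coord M p p)) v)"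

definition differential ::
  "('m, 'e::real_normed_vector, 'z) charted_scheme \<Rightarrow> ('m \<Rightarrow> real) \<Rightarrow> 'm \<Rightarrow> 'e \<Rightarrow>\<^sub>L real" where
  "differential M f p = Blinfun (\<lambda>v. pairing M f (p, v))"

definition tangent_lift ::
  "('m, 'e::real_normed_vector, 'z) charted_scheme \<Rightarrow> real set \<Rightarrow> (real \<Rightarrow> 'm) \<Rightarrow> real \<Rightarrow> 'm \<times> 'e" where
  "tangent_lift M J c t = (c t, vector_derivative (coord M (c t) \<circ> c) (at t within J))"

text \<open>
  An element \<open>((q, v), (w, z))\<close> of the double tangent bundle has coordinates \<open>v\<close>, \<open>w\<close>, \<open>z\<close> with
  respect to the chart induced by the single chart \<open>coord M q\<close>, so the canonical flip is the
  following interchange.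
\<close>

definition canonical_flip :: "('m \<times> 'e) \<times> ('e \<times> 'e) \<Rightarrow> ('m \<times> 'e) \<times> ('e \<times> 'e)" where
  "canonical_flip = (\<lambda>((q, v), (w, z)). ((q, w), (v, z)))"

text \<open>The vectors tangent to a submanifold \<open>D\<close>, as velocities of smooth curves lying in \<open>D\<close>:\<close>

definition tangent_vectors_to ::
  "('m, 'e::real_normed_vector, 'z) charted_scheme \<Rightarrow> 'm set \<Rightarrow> ('m \<times> 'e) set" where
  "tangent_vectors_to M D =
     {tangent_lift M {-\<epsilon><..<\<epsilon>} c 0 |c \<epsilon>.
        \<epsilon> > 0 \<and> smooth_curve M {-\<epsilon><..<\<epsilon>} c \<and> c ` {-\<epsilon><..<\<epsilon>} \<subseteq> D}"

text \<open>
  A vector field assigns to \<open>q\<close> the coordinates of its value in the chart preferred at \<open>q\<close>;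
  \<open>local_field M p X\<close> is its expression in the chart preferred at \<open>p\<close>.
\<close>

definition local_field ::
  "('m, 'e::real_normed_vector, 'z) charted_scheme \<Rightarrow> 'm \<Rightarrow> ('m \<Rightarrow> 'e) \<Rightarrow> 'e \<Rightarrow> 'e" where
  "local_field M p X = (\<lambda>x. snd (coord (tangent_bundle M) (p, 0) (param M p x, X (param M p x))))"

definition vf_bracket ::
  "('m, 'e::real_normed_vector, 'z) charted_scheme \<Rightarrow> ('m \<Rightarrow> 'e) \<Rightarrow> ('m \<Rightarrow> 'e) \<Rightarrow> 'm \<Rightarrow> 'e" where
  "vf_bracket M X Y p =
     frechet_derivative (local_field M p Y) (at (coord M p p)) (local_field M p X (coord M p p)) -
     frechet_derivative (local_field M p X) (at (coord M p p)) (local_field M p Y (coord M p p))"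


section \<open>Lie groups\<close>

record ('h, 'e) lie_data = "('h, 'e) charted" +
  gmult :: "'h \<Rightarrow> 'h \<Rightarrow> 'h"
  gone :: 'h
  ginv :: "'h \<Rightarrow> 'h"

definition lie_group :: "('h, 'e::real_inner) lie_data \<Rightarrow> bool" where
  "lie_group G \<longleftrightarrow>
     smooth_manifold G \<and>
     Groups.group (gmult G) (gone G) (ginv G) \<and>
     smooth_map (prod_manifold G G) G (\<lambda>(g, k). gmult G g k) \<and>
     smooth_map G G (ginv G)"

text \<open>
  The Lie algebra is the tangent space at the identity, that is \<open>'e\<close> by means of the chart
  preferred at the identity. \<open>left_triv G (h, \<eta>)\<close> is the left translate of \<open>\<eta>\<close> to the tangent space at \<open>h\<close>.
\<close>

definition left_triv :: "('h, 'e::real_normed_vector) lie_data \<Rightarrow> 'h \<times> 'e \<Rightarrow> 'h \<times> 'e" where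
  "left_triv G = (\<lambda>(h, \<eta>). tangent_map G G (gmult G h) (gone G, \<eta>))"

definition lie_bracket :: "('h, 'e::real_normed_vector) lie_data \<Rightarrow> 'e \<Rightarrow> 'e \<Rightarrow> 'e" where
  "lie_bracket G \<xi> \<eta> =
     vf_bracket G (\<lambda>g. snd (left_triv G (g, \<xi>))) (\<lambda>g. snd (left_triv G (g, \<eta>))) (gone G)"


section \<open>Duals and splittings\<close>

definition dual_map ::
  "('v::real_normed_vector \<Rightarrow> 'w::real_normed_vector) \<Rightarrow> ('w \<Rightarrow>\<^sub>L real) \<Rightarrow> ('v \<Rightarrow>\<^sub>L real)" where
  "dual_map A \<phi> = Blinfun (\<lambda>v. \<phi> (A v))"

definition ad_star ::
  "('h, 'e::real_normed_vector) lie_data \<Rightarrow> 'e \<Rightarrow> ('e \<Rightarrow>\<^sub>L real) \<Rightarrow> ('e \<Rightarrow>\<^sub>L real)" where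
  "ad_star G \<eta> = dual_map (lie_bracket G \<eta>)"

definition Ann :: "'v::real_normed_vector set \<Rightarrow> ('v \<Rightarrow>\<^sub>L real) set" where
  "Ann S = {\<phi> :: 'v \<Rightarrow>\<^sub>L real. \<forall>v\<in>S. \<phi> v = 0}"

definition splitting ::
  "'v::real_vector set \<Rightarrow> 'v set \<Rightarrow> ('v \<Rightarrow> 'v) \<Rightarrow> ('v \<Rightarrow> 'v) \<Rightarrow> bool" where
  "splitting d d' P P' \<longleftrightarrow>
     subspace d \<and> subspace d' \<and> d \<inter> d' = {0} \<and>
     (\<forall>v. P v \<in> d \<and> P' v \<in> d' \<and> P v + P' v = v)"


section \<open>Variational calculus on a Lie group\<close>

definition partial_h ::
  "('h, 'e::real_normed_vector) lie_data \<Rightarrow> ('h \<times> 'e \<Rightarrow> real) \<Rightarrow> 'h \<Rightarrow> 'e \<Rightarrow> 'e \<Rightarrow>\<^sub>L real" where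
  "partial_h G L h \<eta> = differential G (\<lambda>g. L (g, \<eta>)) h"

definition partial_eta ::
  "('h \<times> 'e::real_normed_vector \<Rightarrow> real) \<Rightarrow> 'h \<Rightarrow> 'e \<Rightarrow> 'e \<Rightarrow>\<^sub>L real" where
  "partial_eta L h \<eta> = Blinfun (frechet_derivative (\<lambda>\<zeta>. L (h, \<zeta>)) (at \<eta>))"

definition left_invariant :: "('h, 'e) lie_data \<Rightarrow> ('h \<times> 'e \<Rightarrow> real) \<Rightarrow> bool" where
  "left_invariant G L \<longleftrightarrow> (\<forall>g h \<eta>. L (gmult G g h, \<eta>) = L (h, \<eta>))"

definition left_distribution ::
  "('h, 'e::real_normed_vector) lie_data \<Rightarrow> 'e set \<Rightarrow> ('h \<times> 'e) set" where
  "left_distribution G d = left_triv G ` (UNIV \<times> d)"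

definition admissible_curve ::
  "('h, 'e::real_normed_vector) lie_data \<Rightarrow> real \<Rightarrow> real \<Rightarrow> (real \<Rightarrow> 'h) \<Rightarrow> (real \<Rightarrow> 'e) \<Rightarrow> bool" where
  "admissible_curve G t0 t1 h \<eta> \<longleftrightarrow>
     smooth_curve G {t0..t1} h \<and> smooth_on {t0..t1} \<eta> \<and>
     (\<forall>t\<in>{t0..t1}. left_triv G (h t, \<eta> t) = tangent_lift G {t0..t1} h t)"

definition constrained_curve ::
  "('h, 'e::real_normed_vector) lie_data \<Rightarrow> 'e set \<Rightarrow> real \<Rightarrow> real \<Rightarrow>
   (real \<Rightarrow> 'h) \<Rightarrow> (real \<Rightarrow> 'e) \<Rightarrow> bool" where
  "constrained_curve G d t0 t1 h \<eta> \<longleftrightarrow>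
     admissible_curve G t0 t1 h \<eta> \<and> (\<forall>t\<in>{t0..t1}. \<eta> t \<in> d)"

definition generators :: "real \<Rightarrow> real \<Rightarrow> (real \<Rightarrow> 'e::real_normed_vector) set" where
  "generators t0 t1 = {\<xi>. smooth_on {t0..t1} \<xi> \<and> \<xi> t0 = 0 \<and> \<xi> t1 = 0}"

text \<open>
  The admissible variation along the tangent lift of \<open>h\<close>; it is a vector in the double tangent
  bundle, including its base point.
\<close>

definition variation ::
  "('h, 'e::real_normed_vector) lie_data \<Rightarrow> real \<Rightarrow> real \<Rightarrow> (real \<Rightarrow> 'h) \<Rightarrow> (real \<Rightarrow> 'e) \<Rightarrow>
   real \<Rightarrow> ('h \<times> 'e) \<times> ('e \<times> 'e)" where
  "variation G t0 t1 h \<xi> t =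
     canonical_flip
       (tangent_lift (tangent_bundle G) {t0..t1} (\<lambda>s. left_triv G (h s, \<xi> s)) t)"

text \<open>
  A (possibly time-dependent) Lagrangian on the trivialised bundle is transported to the tangent
  bundle by \<open>inv (left_triv G)\<close>.
\<close>

definition dS ::
  "('h, 'e::real_normed_vector) lie_data \<Rightarrow> real \<Rightarrow> real \<Rightarrow> (real \<Rightarrow> 'h \<times> 'e \<Rightarrow> real) \<Rightarrow>
   (real \<Rightarrow> 'h) \<Rightarrow> (real \<Rightarrow> 'e) \<Rightarrow> real" where
  "dS G t0 t1 L h \<xi> =
     integral {t0..t1}
       (\<lambda>t. pairing (tangent_bundle G) (L t \<circ> inv (left_triv G)) (variation G t0 t1 h \<xi> t))"

definition unconstrained_extremal ::
  "('h, 'e::real_normed_vector) lie_data \<Rightarrow> 'e set \<Rightarrow> real \<Rightarrow> real \<Rightarrow>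
   (real \<Rightarrow> 'h \<times> 'e \<Rightarrow> real) \<Rightarrow> (real \<Rightarrow> 'h) \<Rightarrow> (real \<Rightarrow> 'e) \<Rightarrow> bool" where
  "unconstrained_extremal G d t0 t1 L h \<eta> \<longleftrightarrow>
     constrained_curve G d t0 t1 h \<eta> \<and>
     (\<forall>\<xi>\<in>generators t0 t1. dS G t0 t1 L h \<xi> = 0)"

definition nonholonomic_extremal ::
  "('h, 'e::real_normed_vector) lie_data \<Rightarrow> 'e set \<Rightarrow> real \<Rightarrow> real \<Rightarrow>
   (real \<Rightarrow> 'h \<times> 'e \<Rightarrow> real) \<Rightarrow> (real \<Rightarrow> 'h) \<Rightarrow> (real \<Rightarrow> 'e) \<Rightarrow> bool" where
  "nonholonomic_extremal G d t0 t1 L h \<eta> \<longleftrightarrow>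
     constrained_curve G d t0 t1 h \<eta> \<and>
     (\<forall>\<xi>\<in>generators t0 t1. (\<forall>t\<in>{t0..t1}. \<xi> t \<in> d) \<longrightarrow> dS G t0 t1 L h \<xi> = 0)"

definition vakonomic_extremal ::
  "('h, 'e::real_normed_vector) lie_data \<Rightarrow> 'e set \<Rightarrow> real \<Rightarrow> real \<Rightarrow>
   (real \<Rightarrow> 'h \<times> 'e \<Rightarrow> real) \<Rightarrow> (real \<Rightarrow> 'h) \<Rightarrow> (real \<Rightarrow> 'e) \<Rightarrow> bool" where
  "vakonomic_extremal G d t0 t1 L h \<eta> \<longleftrightarrow>
     constrained_curve G d t0 t1 h \<eta> \<and>
     (\<forall>\<xi>\<in>generators t0 t1.
        (\<forall>t\<in>{t0..t1}. variation G t0 t1 h \<xi> t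
           \<in> tangent_vectors_to (tangent_bundle G) (left_distribution G d)) \<longrightarrow>
        dS G t0 t1 L h \<xi> = 0)"

definition vakonomic_extremal_with_multiplier ::
  "('h, 'e::real_normed_vector) lie_data \<Rightarrow> 'e set \<Rightarrow> ('e \<Rightarrow> 'e) \<Rightarrow> real \<Rightarrow> real \<Rightarrow>
   ('h \<times> 'e \<Rightarrow> real) \<Rightarrow> (real \<Rightarrow> 'e \<Rightarrow>\<^sub>L real) \<Rightarrow> (real \<Rightarrow> 'h) \<Rightarrow> (real \<Rightarrow> 'e) \<Rightarrow> bool" where
  "vakonomic_extremal_with_multiplier G d P' t0 t1 L \<mu> h \<eta> \<longleftrightarrow>
     smooth_on {t0..t1} \<mu> \<and>
     (\<forall>t\<in>{t0..t1}. \<mu> t = dual_map P' (\<mu> t) \<and> \<mu> t \<in> Ann d) \<and>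
     unconstrained_extremal G d t0 t1 (\<lambda>t (g, \<zeta>). L (g, \<zeta>) - \<mu> t (P' \<zeta>)) h \<eta>"

end

theory Submission
  imports Defs
begin

text \<open>
Left translation turns the problem on \<open>H\<close> into one on the Lie algebra. Along an admissible curve with
angular velocity \<open>\<eta>\<close>, the variation generated by \<open>\<xi>\<close> changes the angular velocity by
\<open>\<xi>' + [\<eta>, \<xi>]\<close> (\<open>variation_angular_velocity\<close>). A left-invariant Lagrangian depends on the angular
velocity alone, so with \<open>p = \<partial>L/\<partial>\<eta>\<close> the first variation of the action is
\<open>\<integral> \<langle>p, \<xi>' + [\<eta>, \<xi>]\<rangle> dt\<close>, which equals \<open>- \<integral> \<langle>p' - ad\<^sup>*\<^sub>\<eta> p, \<xi>\<rangle> dt\<close> by parts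
(\<open>dS_EL\<close>). The fundamental lemma of the calculus of variations then says that the action is stationary
for all \<open>\<xi>\<close> with values in a subspace \<open>d\<close> exactly if \<open>p' - ad\<^sup>*\<^sub>\<eta> p\<close> annihilates \<open>d\<close>
(\<open>stationary_iff\<close>). With the given \<open>d\<close> this is the nonholonomic equation, with the whole algebra the
unconstrained one, and since \<open>Ann d \<inter> Ann d' = 0\<close> the two differ by the condition \<open>Ann d'\<close>. A multiplier
replaces \<open>L\<close> by another left-invariant Lagrangian, with momentum \<open>p - \<lambda>\<close>.

For vakonomic extremals, the same formula for the change of angular velocity shows that the
variation is tangent to \<open>D\<close> exactly if \<open>\<xi>' + [\<eta>, \<xi>]\<close> lies in \<open>d\<close>
(\<open>tangent_to_distribution_iff\<close>). Writing \<open>\<xi> = a + b\<close> with \<open>a\<close> in \<open>d\<close> and \<open>b\<close> in \<open>d'\<close>, this is the differential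
equation relating \<open>a\<close> and \<open>b\<close>; for a nonholonomic extremal \<open>a\<close> contributes nothing to the first
variation, and substituting the equation for \<open>b'\<close> in the contribution of \<open>b\<close> gives the difference of the two
integrals.

The geometric content is the formula \<open>\<xi>' + [\<eta>, \<xi>]\<close>. In a chart, the left-invariant field with value
\<open>\<zeta>\<close> at the identity is \<open>x \<mapsto> A(x) \<zeta>\<close>, where \<open>A(x)\<close> is a partial derivative of the multiplication. The
derivative of the lifted curve \<open>A(x) \<xi>\<close> and the flip produce \<open>A \<xi>' + dA(A \<eta>) \<xi>\<close>, whereas
keeping the angular velocity constant while the base point moves along \<open>A \<xi>\<close> produces
\<open>dA(A \<xi>) \<eta>\<close>; the difference \<open>dA(A \<eta>) \<xi> - dA(A \<xi>) \<eta>\<close> is the bracket of the two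
left-invariant fields at the point considered. It is the translate of the bracket at the identity
(\<open>bracket_in_chart\<close>), because in the transformation law of \<open>dA\<close> the only term that is not
tensorial is a second derivative, which is symmetric.
\<close>

section \<open>Calculus of smooth maps\<close>

lemma has_derivative_within_cong:
  assumes "x \<in> S" "\<And>y. y \<in> S \<Longrightarrow> f y = g y"
  shows "(f has_derivative D) (at x within S) \<longleftrightarrow> (g has_derivative D) (at x within S)"
  using assms by (metis has_derivative_transform)

lemma frechet_derivative_within_cong:
  assumes "x \<in> S" "\<And>y. y \<in> S \<Longrightarrow> f y = g y"
  shows "frechet_derivative f (at x within S) = frechet_derivative g (at x within S)"
  unfolding frechet_derivative_def using has_derivative_within_cong[OF assms] by simp

lemma times_differentiable_on_cong:
  assumes "\<And>x. x \<in> S \<Longrightarrow> f x = g x"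
  shows "times_differentiable_on k S f \<longleftrightarrow> times_differentiable_on k S g"
  using assms
proof (induction k arbitrary: f g)
  case 0
  then show ?case by (simp cong: continuous_on_cong)
next
  case (Suc k)
  have "f differentiable (at x within S) \<longleftrightarrow> g differentiable (at x within S)" if "x \<in> S" for x
    unfolding differentiable_def using has_derivative_within_cong[OF that, of f g] Suc.prems by simp
  moreover have "times_differentiable_on k S (\<lambda>x. frechet_derivative f (at x within S) v) \<longleftrightarrow>
      times_differentiable_on k S (\<lambda>x. frechet_derivative g (at x within S) v)" for v
    by (rule Suc.IH) (metis frechet_derivative_within_cong Suc.prems)
  ultimately show ?case by simp
qed

lemma times_differentiable_on_Suc_imp:
  "times_differentiable_on (Suc k) S f \<Longrightarrow> times_differentiable_on k S f"
proof (induction k arbitrary: f)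
  case 0
  then show ?case
    by (auto simp: continuous_on_eq_continuous_within differentiable_imp_continuous_within)
next
  case (Suc k)
  then show ?case by (metis times_differentiable_on.simps(2))
qed

lemma smooth_on_imp_has_derivative:
  assumes "smooth_on S f" "open S" "x \<in> S"
  shows "(f has_derivative frechet_derivative f (at x)) (at x)"
proof -
  have "times_differentiable_on (Suc 0) S f" using assms(1) smooth_on_def by blast
  then have "f differentiable (at x within S)" using assms(3) by simp
  then show ?thesis using assms(2,3) at_within_open[of x S] by (simp add: frechet_derivative_works)
qed

lemma smooth_on_directional_derivative:
  assumes "smooth_on S f" "open S"
  shows "smooth_on S (\<lambda>x. frechet_derivative f (at x) v)"
  unfolding smooth_on_def
proof
  fix k
  have "times_differentiable_on (Suc k) S f" using assms(1) smooth_on_def by blast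
  then have "times_differentiable_on k S (\<lambda>x. frechet_derivative f (at x within S) v)" by simp
  moreover have "frechet_derivative f (at x within S) v = frechet_derivative f (at x) v" if "x \<in> S" for x
    using that assms(2) at_within_open[of x S] by simp
  ultimately show "times_differentiable_on k S (\<lambda>x. frechet_derivative f (at x) v)"
    using times_differentiable_on_cong[of S "\<lambda>x. frechet_derivative f (at x within S) v"
        "\<lambda>x. frechet_derivative f (at x) v"] by blast
qed

lemma smooth_on_imp_continuous_on: "smooth_on S f \<Longrightarrow> continuous_on S f"
  unfolding smooth_on_def using times_differentiable_on.simps(1) by blast

lemma smooth_on_cong: "(\<And>x. x \<in> S \<Longrightarrow> f x = g x) \<Longrightarrow> smooth_on S f \<longleftrightarrow> smooth_on S g"
  unfolding smooth_on_def using times_differentiable_on_cong by blast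

lemma has_derivative_eventually_cong:
  assumes "(f has_derivative D) (at x)" "\<forall>\<^sub>F y in nhds x. f y = g y"
  shows "(g has_derivative D) (at x)"
  by (rule has_derivative_transform_eventually[OF assms(1)])
    (use assms(2) in \<open>auto simp: eventually_nhds_conv_at\<close>)

lemma has_vector_derivative_eventually_cong:
  assumes "(f has_vector_derivative D) (at x within S)" "x \<in> S"
    and "\<forall>\<^sub>F y in at x within S. f y = g y" "f x = g x"
  shows "(g has_vector_derivative D) (at x within S)"
  using has_derivative_transform_eventually[OF assms(1)[unfolded has_vector_derivative_def] assms(3,4,2)]
  by (simp add: has_vector_derivative_def)

text \<open>
As for lines: the derivatives of the slice are slices of directional derivatives.
\<close>

lemma smooth_on_slice:
  fixes F :: "'a::real_normed_vector \<times> 'b::real_normed_vector \<Rightarrow> 'c::real_normed_vector"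
  assumes "smooth_on W F" "open W" "\<And>y. (a, y) \<in> W"
  shows "smooth_on UNIV (\<lambda>y. F (a, y))"
proof -
  have "times_differentiable_on k UNIV (\<lambda>y. F (a, y))" if "smooth_on W F" for k
    using that
  proof (induction k arbitrary: F)
    case 0
    have "continuous_on UNIV (Pair a :: 'b \<Rightarrow> _)" by (intro continuous_intros)
    moreover have "range (Pair a) \<subseteq> W" using assms(3) by blast
    ultimately show ?case
      using continuous_on_compose2[OF smooth_on_imp_continuous_on[OF 0]] by simp
  next
    case (Suc k)
    have D: "((\<lambda>y. F (a, y)) has_derivative (\<lambda>v. frechet_derivative F (at (a, y)) (0, v))) (at y)" for y
      by (rule has_derivative_compose[OF has_derivative_Pair[OF has_derivative_const has_derivative_ident]
            smooth_on_imp_has_derivative[OF Suc.prems assms(2,3)]])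
    have "frechet_derivative (\<lambda>y. F (a, y)) (at y) = (\<lambda>v. frechet_derivative F (at (a, y)) (0, v))" for y
      using frechet_derivative_at[OF D] by simp
    moreover have "(\<lambda>y. F (a, y)) differentiable (at y)" for y
      unfolding differentiable_def
      using D[of y] by (rule exI[of _ "\<lambda>v. frechet_derivative F (at (a, y)) (0, v)"])
    ultimately show ?case
      using Suc.IH[OF smooth_on_directional_derivative[OF Suc.prems assms(2)]] by simp
  qed
  with assms(1) show ?thesis unfolding smooth_on_def by blast
qed

subsection \<open>Functions of one real variable\<close>

text \<open>
Derivatives within a set of reals are unique exactly under this condition. It covers both open sets
and the closed interval on which generators live.
\<close>

definition perfect :: "real set \<Rightarrow> bool" where
  "perfect S \<longleftrightarrow> (\<forall>x\<in>S. at x within S \<noteq> bot)"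

lemma perfect_open: "open S \<Longrightarrow> perfect S"
  unfolding perfect_def by (metis at_within_open trivial_limit_at)

lemma perfect_interval: "t0 < t1 \<Longrightarrow> perfect {t0..t1}"
  unfolding perfect_def
  by (auto simp: trivial_limit_within islimpt_Icc simp del: at_within_eq_bot_iff)

lemma frechet_derivative_within_eq:
  assumes "perfect S" "x \<in> S" "(f has_derivative D) (at x within S)"
  shows "frechet_derivative f (at x within S) = D"
proof -
  let ?F = "frechet_derivative f (at x within S)"
  have F: "(f has_derivative ?F) (at x within S)"
    using assms(3) differentiable_def frechet_derivative_works by blast
  have v: "(f has_vector_derivative E 1) (at x within S)" if "(f has_derivative E) (at x within S)" for E
    using that unfolding has_vector_derivative_def
    by (rule has_derivative_eq_rhs)
      (metis has_derivative_linear linear_cmul that mult.right_neutral real_scaleR_def)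
  have eq1: "?F 1 = D 1"
    using vector_derivative_unique_within[OF _ v[OF F] v[OF assms(3)]] assms(1,2)
    unfolding perfect_def by auto
  show ?thesis
  proof
    fix r :: real
    have "?F (r *\<^sub>R 1) = D (r *\<^sub>R 1)"
      using eq1 has_derivative_linear[OF F] has_derivative_linear[OF assms(3)]
      by (metis linear_cmul)
    then show "?F r = D r" by simp
  qed
qed

lemma times_differentiable_on_bounded_linear:
  fixes f :: "real \<Rightarrow> 'a::real_normed_vector"
  assumes "bounded_linear A" "perfect S" "times_differentiable_on k S f"
  shows "times_differentiable_on k S (\<lambda>x. A (f x))"
  using assms(3)
proof (induction k arbitrary: f)
  case 0
  then show ?case using bounded_linear.continuous_on[OF assms(1)] by auto
next
  case (Suc k)
  have D: "((\<lambda>x. A (f x)) has_derivative (\<lambda>v. A (frechet_derivative f (at x within S) v))) (at x within S)"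
    if "x \<in> S" for x
    using Suc.prems that by (simp add: frechet_derivative_works bounded_linear.has_derivative[OF assms(1)])
  have "times_differentiable_on k S (\<lambda>x. frechet_derivative (\<lambda>x. A (f x)) (at x within S) v)" for v
  proof -
    have "times_differentiable_on k S (\<lambda>x. A (frechet_derivative f (at x within S) v))"
      using Suc.prems by (intro Suc.IH) simp
    then show ?thesis
      by (subst times_differentiable_on_cong) (simp_all add: frechet_derivative_within_eq[OF assms(2) _ D])
  qed
  with D show ?case by (auto simp: differentiable_def)
qed

text \<open>
On the real line one directional derivative determines them all, so iterated differentiability
reduces to a recursion on the velocity. The closure properties below are inductions on it.
\<close>

lemma times_differentiable_on_Suc_iff:
  fixes f :: "real \<Rightarrow> 'a::real_normed_vector"
  assumes "perfect S"
  shows "times_differentiable_on (Suc k) S f \<longleftrightarrow>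
    (\<exists>f'. (\<forall>x\<in>S. (f has_vector_derivative f' x) (at x within S)) \<and> times_differentiable_on k S f')"
    (is "?L \<longleftrightarrow> ?R")
proof
  assume L: ?L
  have "(f has_vector_derivative frechet_derivative f (at x within S) 1) (at x within S)" if "x \<in> S" for x
  proof -
    have F: "(f has_derivative frechet_derivative f (at x within S)) (at x within S)"
      using L that by (simp add: frechet_derivative_works)
    then show ?thesis unfolding has_vector_derivative_def
      by (rule has_derivative_eq_rhs)
        (metis has_derivative_linear linear_cmul F mult.right_neutral real_scaleR_def)
  qed
  moreover have "times_differentiable_on k S (\<lambda>x. frechet_derivative f (at x within S) 1)"
    using L by simp
  ultimately show ?R by (intro exI[of _ "\<lambda>x. frechet_derivative f (at x within S) 1"] conjI ballI)
next
  assume ?R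
  then obtain f' where f': "\<And>x. x \<in> S \<Longrightarrow> (f has_vector_derivative f' x) (at x within S)"
    "times_differentiable_on k S f'" by blast
  have "frechet_derivative f (at x within S) v = v *\<^sub>R f' x" if "x \<in> S" for x v
    using frechet_derivative_within_eq[OF assms that f'(1)[OF that, unfolded has_vector_derivative_def]]
    by simp
  then have "times_differentiable_on k S (\<lambda>x. frechet_derivative f (at x within S) v)" for v
    using times_differentiable_on_bounded_linear[OF bounded_linear_scaleR_right assms f'(2)]
    by (subst times_differentiable_on_cong) auto
  with f'(1) show ?L by (auto simp: differentiable_def has_vector_derivative_def)
qed

lemma times_differentiable_on_const:
  fixes c :: "'a::real_normed_vector"
  assumes "perfect S" shows "times_differentiable_on k S (\<lambda>_. c)"
proof (induction k arbitrary: c)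
  case (Suc k)
  show ?case unfolding times_differentiable_on_Suc_iff[OF assms]
    by (intro exI[of _ "\<lambda>_. 0"] conjI ballI has_vector_derivative_const Suc.IH)
qed simp

lemma times_differentiable_on_add:
  fixes f g :: "real \<Rightarrow> 'a::real_normed_vector"
  assumes "perfect S" "times_differentiable_on k S f" "times_differentiable_on k S g"
  shows "times_differentiable_on k S (\<lambda>x. f x + g x)"
  using assms(2,3)
proof (induction k arbitrary: f g)
  case 0
  then show ?case by (simp add: continuous_on_add)
next
  case (Suc k)
  obtain f' g' where f': "\<And>x. x \<in> S \<Longrightarrow> (f has_vector_derivative f' x) (at x within S)"
      "times_differentiable_on k S f'"
    and g': "\<And>x. x \<in> S \<Longrightarrow> (g has_vector_derivative g' x) (at x within S)"
      "times_differentiable_on k S g'"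
    using Suc.prems unfolding times_differentiable_on_Suc_iff[OF assms(1)] by blast
  have "times_differentiable_on k S (\<lambda>x. f' x + g' x)" by (intro Suc.IH f' g')
  then show ?case unfolding times_differentiable_on_Suc_iff[OF assms(1)]
    by (intro exI[of _ "\<lambda>x. f' x + g' x"] conjI ballI has_vector_derivative_add f' g')
qed

lemma times_differentiable_on_scaleR:
  fixes f :: "real \<Rightarrow> real" and g :: "real \<Rightarrow> 'a::real_normed_vector"
  assumes "perfect S" "times_differentiable_on k S f" "times_differentiable_on k S g"
  shows "times_differentiable_on k S (\<lambda>x. f x *\<^sub>R g x)"
  using assms(2,3)
proof (induction k arbitrary: f g)
  case 0
  then show ?case by (simp add: continuous_on_scaleR)
next
  case (Suc k)
  note k = Suc.prems[THEN times_differentiable_on_Suc_imp]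
  obtain f' g' where f': "\<And>x. x \<in> S \<Longrightarrow> (f has_vector_derivative f' x) (at x within S)"
      "times_differentiable_on k S f'"
    and g': "\<And>x. x \<in> S \<Longrightarrow> (g has_vector_derivative g' x) (at x within S)"
      "times_differentiable_on k S g'"
    using Suc.prems unfolding times_differentiable_on_Suc_iff[OF assms(1)] by blast
  have "((\<lambda>x. f x *\<^sub>R g x) has_vector_derivative (f x *\<^sub>R g' x + f' x *\<^sub>R g x)) (at x within S)"
    if "x \<in> S" for x
    by (rule bounded_bilinear.has_vector_derivative[OF bounded_bilinear_scaleR f'(1)[OF that] g'(1)[OF that]])
  moreover have "times_differentiable_on k S (\<lambda>x. f x *\<^sub>R g' x + f' x *\<^sub>R g x)"
    by (intro times_differentiable_on_add assms(1) Suc.IH f' g' k)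
  ultimately show ?case unfolding times_differentiable_on_Suc_iff[OF assms(1)] by (intro exI conjI ballI)
qed

lemma times_differentiable_on_Pair:
  fixes f :: "real \<Rightarrow> 'a::real_normed_vector" and g :: "real \<Rightarrow> 'b::real_normed_vector"
  assumes "perfect S" "times_differentiable_on k S f" "times_differentiable_on k S g"
  shows "times_differentiable_on k S (\<lambda>x. (f x, g x))"
  using assms(2,3)
proof (induction k arbitrary: f g)
  case 0
  then show ?case by (simp add: continuous_on_Pair)
next
  case (Suc k)
  obtain f' g' where f': "\<And>x. x \<in> S \<Longrightarrow> (f has_vector_derivative f' x) (at x within S)"
      "times_differentiable_on k S f'"
    and g': "\<And>x. x \<in> S \<Longrightarrow> (g has_vector_derivative g' x) (at x within S)"
      "times_differentiable_on k S g'"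
    using Suc.prems unfolding times_differentiable_on_Suc_iff[OF assms(1)] by blast
  have "times_differentiable_on k S (\<lambda>x. (f' x, g' x))" by (intro Suc.IH f' g')
  then show ?case unfolding times_differentiable_on_Suc_iff[OF assms(1)]
    by (intro exI[of _ "\<lambda>x. (f' x, g' x)"] conjI ballI has_vector_derivative_Pair f' g')
qed

lemma times_differentiable_on_polynomial:
  fixes p :: "real \<Rightarrow> real"
  assumes "perfect S" "real_polynomial_function p"
  shows "times_differentiable_on k S p"
  using assms(2)
proof (induction k arbitrary: p)
  case 0
  then show ?case
    by (simp add: continuous_on_polymonial_function real_polynomial_function_eq)
next
  case (Suc k)
  then obtain p' where p': "real_polynomial_function p'" "\<And>x. (p has_real_derivative p' x) (at x)"
    using has_real_derivative_polynomial_function by blast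
  then have "\<forall>x\<in>S. (p has_vector_derivative p' x) (at x within S)"
    by (metis has_real_derivative_iff_has_vector_derivative has_vector_derivative_at_within)
  with Suc.IH[OF p'(1)] show ?case unfolding times_differentiable_on_Suc_iff[OF assms(1)]
    by (intro exI[of _ p'] conjI)
qed

text \<open>
Every derivative along the line is itself the restriction of a directional derivative, which makes
the induction go through.
\<close>

lemma smooth_on_along_line:
  assumes "smooth_on W f" "open W" "perfect S" "\<And>s. s \<in> S \<Longrightarrow> a + s *\<^sub>R b \<in> W"
  shows "smooth_on S (\<lambda>s. f (a + s *\<^sub>R b))"
proof -
  have "times_differentiable_on k S (\<lambda>s. f (a + s *\<^sub>R b))" if "smooth_on W f" for k
    using that
  proof (induction k arbitrary: f)
    case 0
    have "continuous_on S (\<lambda>s. a + s *\<^sub>R b)" by (intro continuous_intros)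
    moreover have "(\<lambda>s. a + s *\<^sub>R b) ` S \<subseteq> W" using assms(4) by blast
    ultimately show ?case
      using continuous_on_compose2[OF smooth_on_imp_continuous_on[OF 0]] by simp
  next
    case (Suc k)
    have line: "((\<lambda>s. a + s *\<^sub>R b) has_derivative (\<lambda>r. r *\<^sub>R b)) (at s within S)" for s
      by (auto intro!: derivative_eq_intros)
    have "((\<lambda>s. f (a + s *\<^sub>R b)) has_vector_derivative
        frechet_derivative f (at (a + s *\<^sub>R b)) b) (at s within S)" if "s \<in> S" for s
    proof -
      note f = smooth_on_imp_has_derivative[OF Suc.prems assms(2) assms(4)[OF that]]
      show ?thesis
        using has_derivative_compose[OF line f]
        unfolding has_vector_derivative_def linear_cmul[OF has_derivative_linear[OF f]] .
    qed
    moreover have "times_differentiable_on k S (\<lambda>s. frechet_derivative f (at (a + s *\<^sub>R b)) b)"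
      by (rule Suc.IH[OF smooth_on_directional_derivative[OF Suc.prems assms(2)]])
    ultimately show ?case
      unfolding times_differentiable_on_Suc_iff[OF assms(3)]
      by (intro exI[of _ "\<lambda>s. frechet_derivative f (at (a + s *\<^sub>R b)) b"] conjI ballI)
  qed
  with assms(1) show ?thesis unfolding smooth_on_def by blast
qed

lemma smooth_on_bounded_linear:
  fixes f :: "real \<Rightarrow> 'a::real_normed_vector"
  shows "bounded_linear A \<Longrightarrow> perfect S \<Longrightarrow> smooth_on S f \<Longrightarrow> smooth_on S (\<lambda>x. A (f x))"
  unfolding smooth_on_def using times_differentiable_on_bounded_linear by blast

lemma smooth_on_add:
  fixes f g :: "real \<Rightarrow> 'a::real_normed_vector"
  shows "perfect S \<Longrightarrow> smooth_on S f \<Longrightarrow> smooth_on S g \<Longrightarrow> smooth_on S (\<lambda>x. f x + g x)"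
  unfolding smooth_on_def using times_differentiable_on_add by blast

lemma smooth_on_scaleR:
  fixes f :: "real \<Rightarrow> real" and g :: "real \<Rightarrow> 'a::real_normed_vector"
  shows "perfect S \<Longrightarrow> smooth_on S f \<Longrightarrow> smooth_on S g \<Longrightarrow> smooth_on S (\<lambda>x. f x *\<^sub>R g x)"
  unfolding smooth_on_def using times_differentiable_on_scaleR by blast

lemma smooth_on_Pair:
  fixes f :: "real \<Rightarrow> 'a::real_normed_vector" and g :: "real \<Rightarrow> 'b::real_normed_vector"
  shows "perfect S \<Longrightarrow> smooth_on S f \<Longrightarrow> smooth_on S g \<Longrightarrow> smooth_on S (\<lambda>x. (f x, g x))"
  unfolding smooth_on_def using times_differentiable_on_Pair by blast

lemma smooth_on_const:
  fixes c :: "'a::real_normed_vector"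
  shows "perfect S \<Longrightarrow> smooth_on S (\<lambda>_. c)"
  unfolding smooth_on_def using times_differentiable_on_const by blast

lemma smooth_on_polynomial:
  "perfect S \<Longrightarrow> real_polynomial_function p \<Longrightarrow> smooth_on S p"
  unfolding smooth_on_def using times_differentiable_on_polynomial by blast

lemma smooth_on_imp_C1:
  fixes f :: "real \<Rightarrow> 'a::real_normed_vector"
  assumes "perfect S" "smooth_on S f"
  shows "\<And>x. x \<in> S \<Longrightarrow> (f has_vector_derivative vector_derivative f (at x within S)) (at x within S)"
    and "continuous_on S (\<lambda>x. vector_derivative f (at x within S))"
proof -
  have "times_differentiable_on (Suc 0) S f" using assms(2) smooth_on_def by blast
  then obtain f' where f': "\<And>x. x \<in> S \<Longrightarrow> (f has_vector_derivative f' x) (at x within S)"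
      "continuous_on S f'"
    unfolding times_differentiable_on_Suc_iff[OF assms(1)] by auto
  have eq: "vector_derivative f (at x within S) = f' x" if "x \<in> S" for x
    using vector_derivative_within[OF _ f'(1)[OF that]] assms(1) that unfolding perfect_def by auto
  show "(f has_vector_derivative vector_derivative f (at x within S)) (at x within S)"
    if "x \<in> S" for x using f'(1) eq that by simp
  show "continuous_on S (\<lambda>x. vector_derivative f (at x within S))"
    using f'(2) eq by (simp cong: continuous_on_cong)
qed

subsection \<open>Symmetry of second derivatives\<close>

text \<open>
The mean value theorem in the direction \<open>u\<close> and then in the direction \<open>v\<close>. The left-hand
side is symmetric in \<open>u\<close> and \<open>v\<close>, which is what makes mixed second derivatives agree.
\<close>

lemma second_difference:
  fixes f :: "'a::real_normed_vector \<Rightarrow> real"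
  assumes "0 < r"
    and W: "\<And>s t. 0 \<le> s \<Longrightarrow> s \<le> r \<Longrightarrow> 0 \<le> t \<Longrightarrow> t \<le> r \<Longrightarrow> z + s *\<^sub>R u + t *\<^sub>R v \<in> W"
    and f: "\<And>x. x \<in> W \<Longrightarrow> (f has_derivative f' x) (at x)"
    and g: "\<And>x. x \<in> W \<Longrightarrow> ((\<lambda>x. f' x u) has_derivative g x) (at x)"
  shows "\<exists>s t. 0 \<le> s \<and> s \<le> r \<and> 0 \<le> t \<and> t \<le> r \<and>
    f (z + r *\<^sub>R u + r *\<^sub>R v) - f (z + r *\<^sub>R u) - f (z + r *\<^sub>R v) + f z
      = r * r * g (z + s *\<^sub>R u + t *\<^sub>R v) v"
proof -
  define \<phi> where "\<phi> s = f (z + s *\<^sub>R u + r *\<^sub>R v) - f (z + s *\<^sub>R u)" for s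
  have expand: "D (h *\<^sub>R x) = D x * h" if "(k has_derivative D) (at y)"
    for k :: "'a \<Rightarrow> real" and D y h x
    using linear_cmul[OF has_derivative_linear[OF that]] by simp
  have along_u: "((\<lambda>s. f (z + s *\<^sub>R u + t *\<^sub>R v)) has_real_derivative f' (z + s *\<^sub>R u + t *\<^sub>R v) u) (at s)"
    if "0 \<le> s" "s \<le> r" "0 \<le> t" "t \<le> r" for s t
  proof -
    have f_at: "(f has_derivative f' (z + s *\<^sub>R u + t *\<^sub>R v)) (at (z + s *\<^sub>R u + t *\<^sub>R v))"
      by (intro f W that)
    have "((\<lambda>s. z + s *\<^sub>R u + t *\<^sub>R v) has_derivative (\<lambda>h. h *\<^sub>R u)) (at s)"
      by (auto intro!: derivative_eq_intros)
    from has_derivative_compose[OF this f_at] show ?thesis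
      unfolding has_field_derivative_def expand[OF f_at] .
  qed
  have "(\<phi> has_real_derivative f' (z + s *\<^sub>R u + r *\<^sub>R v) u - f' (z + s *\<^sub>R u) u) (at s)"
    if "0 \<le> s" "s \<le> r" for s
    using DERIV_diff[OF along_u[of s r] along_u[of s 0]] that \<open>0 < r\<close>
    by (simp add: \<phi>_def[abs_def])
  then obtain s where s: "0 < s" "s < r"
    "\<phi> r - \<phi> 0 = (r - 0) * (f' (z + s *\<^sub>R u + r *\<^sub>R v) u - f' (z + s *\<^sub>R u) u)"
    using MVT2[OF \<open>0 < r\<close>, of \<phi> "\<lambda>s. f' (z + s *\<^sub>R u + r *\<^sub>R v) u - f' (z + s *\<^sub>R u) u"]
    by metis
  have "((\<lambda>t. f' (z + s *\<^sub>R u + t *\<^sub>R v) u) has_real_derivative g (z + s *\<^sub>R u + t *\<^sub>R v) v) (at t)"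
    if "0 \<le> t" "t \<le> r" for t
  proof -
    have W': "z + s *\<^sub>R u + t *\<^sub>R v \<in> W" using W s that by auto
    have "((\<lambda>t. z + s *\<^sub>R u + t *\<^sub>R v) has_derivative (\<lambda>h. h *\<^sub>R v)) (at t)"
      by (auto intro!: derivative_eq_intros)
    from has_derivative_compose[OF this g[OF W']] show ?thesis
      unfolding has_field_derivative_def expand[OF g[OF W']] .
  qed
  then obtain t where t: "0 < t" "t < r"
    "f' (z + s *\<^sub>R u + r *\<^sub>R v) u - f' (z + s *\<^sub>R u + 0 *\<^sub>R v) u = (r - 0) * g (z + s *\<^sub>R u + t *\<^sub>R v) v"
    using MVT2[OF \<open>0 < r\<close>, of "\<lambda>t. f' (z + s *\<^sub>R u + t *\<^sub>R v) u"
        "\<lambda>t. g (z + s *\<^sub>R u + t *\<^sub>R v) v"]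
    by metis
  show ?thesis
    by (rule exI[of _ s], rule exI[of _ t]) (use s t in \<open>auto simp: \<phi>_def algebra_simps\<close>)
qed

text \<open>
The mixed derivatives, evaluated at two points of a small parallelogram, both equal the second
difference divided by its scale; continuity at \<open>z\<close> finishes the proof.
\<close>

lemma second_derivative_symmetric_real:
  fixes f :: "'a::real_normed_vector \<Rightarrow> real"
  assumes "open W" "z \<in> W"
    and f: "\<And>x. x \<in> W \<Longrightarrow> (f has_derivative f' x) (at x)"
    and gu: "\<And>x. x \<in> W \<Longrightarrow> ((\<lambda>x. f' x u) has_derivative gu x) (at x)"
    and gv: "\<And>x. x \<in> W \<Longrightarrow> ((\<lambda>x. f' x v) has_derivative gv x) (at x)"
    and cu: "continuous_on W (\<lambda>x. gu x v)" and cv: "continuous_on W (\<lambda>x. gv x u)"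
  shows "gu z v = gv z u"
proof -
  have "dist (gu z v) (gv z u) < e" if "0 < e" for e
  proof -
    have "\<forall>\<^sub>F x in nhds z. x \<in> W \<and> dist (gu x v) (gu z v) < e/2 \<and> dist (gv x u) (gv z u) < e/2"
    proof (intro eventually_conj)
      show "\<forall>\<^sub>F x in nhds z. x \<in> W" using assms(1,2) eventually_nhds by blast
      have "isCont (\<lambda>x. gu x v) z" "isCont (\<lambda>x. gv x u) z"
        using cu cv assms(1,2) continuous_on_eq_continuous_at by blast+
      then show "\<forall>\<^sub>F x in nhds z. dist (gu x v) (gu z v) < e/2" "\<forall>\<^sub>F x in nhds z. dist (gv x u) (gv z u) < e/2"
        unfolding continuous_at tendsto_iff using half_gt_zero[OF \<open>0 < e\<close>] \<open>0 < e\<close>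
        by (auto simp: eventually_nhds_conv_at simp del: less_divide_eq_numeral1)
    qed
    then obtain \<delta> where \<delta>: "0 < \<delta>"
      "\<And>x. dist x z < \<delta> \<Longrightarrow> x \<in> W \<and> dist (gu x v) (gu z v) < e/2 \<and> dist (gv x u) (gv z u) < e/2"
      unfolding eventually_nhds_metric by blast
    define N where "N = norm u + norm v + 1"
    have n: "0 < N" by (simp add: N_def add_nonneg_pos)
    \<comment> \<open>small enough for the parallelogram spanned by \<open>r u\<close> and \<open>r v\<close> to stay within \<open>\<delta>\<close> of \<open>z\<close>\<close>
    define r where "r = \<delta> / (2 * N)"
    have r: "0 < r" using \<delta>(1) n by (simp add: r_def)
    have near: "dist (z + s *\<^sub>R u + t *\<^sub>R v) z < \<delta>" if "0 \<le> s" "s \<le> r" "0 \<le> t" "t \<le> r" for s t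
    proof -
      have "dist (z + s *\<^sub>R u + t *\<^sub>R v) z = norm (s *\<^sub>R u + t *\<^sub>R v)" by (simp add: dist_norm add.assoc)
      also have "\<dots> \<le> s * norm u + t * norm v"
        using norm_triangle_ineq[of "s *\<^sub>R u" "t *\<^sub>R v"] that by simp
      also have "\<dots> \<le> r * norm u + r * norm v" using that by (intro add_mono mult_right_mono) auto
      also have "\<dots> \<le> r * N" using r by (simp add: N_def algebra_simps)
      also have "\<dots> = \<delta> / 2" using n by (simp add: r_def)
      also have "\<dots> < \<delta>" using \<delta>(1) by simp
      finally show ?thesis .
    qed
    obtain s t where st: "0 \<le> s" "s \<le> r" "0 \<le> t" "t \<le> r"
      "f (z + r *\<^sub>R u + r *\<^sub>R v) - f (z + r *\<^sub>R u) - f (z + r *\<^sub>R v) + f z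
        = r * r * gu (z + s *\<^sub>R u + t *\<^sub>R v) v"
      using second_difference[OF r, of z u v W f f' gu] near \<delta>(2) f gu by blast
    have near': "dist (z + s *\<^sub>R v + t *\<^sub>R u) z < \<delta>" if "0 \<le> s" "s \<le> r" "0 \<le> t" "t \<le> r" for s t
      using near[OF that(3,4,1,2)] by (simp add: algebra_simps)
    obtain s' t' where st': "0 \<le> s'" "s' \<le> r" "0 \<le> t'" "t' \<le> r"
      "f (z + r *\<^sub>R v + r *\<^sub>R u) - f (z + r *\<^sub>R v) - f (z + r *\<^sub>R u) + f z
        = r * r * gv (z + s' *\<^sub>R v + t' *\<^sub>R u) u"
      using second_difference[OF r, of z v u W f f' gv] near' \<delta>(2) f gv by blast
    have "f (z + r *\<^sub>R v + r *\<^sub>R u) = f (z + r *\<^sub>R u + r *\<^sub>R v)" by (simp add: algebra_simps)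
    then have "r * r * gu (z + s *\<^sub>R u + t *\<^sub>R v) v = r * r * gv (z + s' *\<^sub>R v + t' *\<^sub>R u) u"
      using st(5) st'(5) by linarith
    then have "gu (z + s *\<^sub>R u + t *\<^sub>R v) v = gv (z + s' *\<^sub>R v + t' *\<^sub>R u) u" using r by simp
    then show ?thesis
      using \<delta>(2)[OF near[OF st(1-4)]] \<delta>(2)[OF near'[OF st'(1-4)]]
      by (metis dist_commute dist_triangle_half_l)
  qed
  then show ?thesis by (metis dist_self less_irrefl zero_less_dist_iff)
qed

lemma second_derivative_symmetric:
  fixes f :: "'a::real_normed_vector \<Rightarrow> 'b::real_inner"
  assumes f: "smooth_on W f" and W: "open W" "z \<in> W"
  shows "frechet_derivative (\<lambda>x. frechet_derivative f (at x) u) (at z) v =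
    frechet_derivative (\<lambda>x. frechet_derivative f (at x) v) (at z) u"
    (is "?g u z v = ?g v z u")
proof -
  have "?g u z v \<bullet> w = ?g v z u \<bullet> w" for w
  proof (rule second_derivative_symmetric_real[OF W, where f = "\<lambda>x. f x \<bullet> w"
      and f' = "\<lambda>x v. frechet_derivative f (at x) v \<bullet> w" and gu = "\<lambda>x v. ?g u x v \<bullet> w" and gv = "\<lambda>x u. ?g v x u \<bullet> w"])
    note d = smooth_on_directional_derivative[OF _ W(1)]
    fix x assume x: "x \<in> W"
    show "((\<lambda>x. f x \<bullet> w) has_derivative (\<lambda>v. frechet_derivative f (at x) v \<bullet> w)) (at x)"
      by (intro has_derivative_inner_left smooth_on_imp_has_derivative[OF f W(1) x])
    show "((\<lambda>x. frechet_derivative f (at x) u \<bullet> w) has_derivative (\<lambda>v. ?g u x v \<bullet> w)) (at x)"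
      "((\<lambda>x. frechet_derivative f (at x) v \<bullet> w) has_derivative (\<lambda>u. ?g v x u \<bullet> w)) (at x)"
      by (intro has_derivative_inner_left smooth_on_imp_has_derivative[OF d[OF f] W(1) x])+
  next
    note d = smooth_on_directional_derivative[OF _ W(1)]
    show "continuous_on W (\<lambda>x. ?g u x v \<bullet> w)" "continuous_on W (\<lambda>x. ?g v x u \<bullet> w)"
      by (intro continuous_intros smooth_on_imp_continuous_on[OF d[OF d[OF f]]])+
  qed
  then show ?thesis by (metis inner_commute vector_eq_ldot)
qed

section \<open>Finite-dimensional inner product spaces\<close>

text \<open>
The expansion that an orthonormal basis provides, stated for a finite set of vectors so that the empty set has it
in dimension zero.
\<close>

definition frame :: "'a::real_inner set \<Rightarrow> bool" where
  "frame B \<longleftrightarrow> finite B \<and> (\<forall>x. x = (\<Sum>b\<in>B. (x \<bullet> b) *\<^sub>R b))"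

text \<open>
Gram--Schmidt gives an orthogonal spanning set; its nonzero members are normalised.
\<close>

lemma frame_exists:
  assumes "finite (A::'a::real_inner set)" "span A = UNIV"
  shows "\<exists>B::'a set. frame B"
proof -
  obtain C where C: "finite C" "span C = (UNIV :: 'a set)" "pairwise orthogonal C"
    using basis_orthogonal[OF assms(1)] assms(2) by auto
  define n where "n c = c /\<^sub>R norm c" for c :: 'a
  define B where "B = n ` (C - {0})"
  have fin: "finite B" using C(1) by (simp add: B_def)
  have unit: "b \<bullet> b = 1" if "b \<in> B" for b
  proof -
    obtain c where "c \<noteq> 0" "b = n c" using \<open>b \<in> B\<close> unfolding B_def by blast
    then have "norm b = 1" by (simp add: n_def)
    then show ?thesis by (simp add: dot_square_norm)
  qed
  have orth: "b \<bullet> b' = 0" if "b \<in> B" "b' \<in> B" "b \<noteq> b'" for b b'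
  proof -
    obtain c c' where c: "c \<in> C" "c' \<in> C" "b = n c" "b' = n c'"
      using \<open>b \<in> B\<close> \<open>b' \<in> B\<close> unfolding B_def by blast
    then have "orthogonal c c'" using C(3) that(3) unfolding pairwise_def by metis
    then show ?thesis using c by (simp add: n_def orthogonal_def)
  qed
  have "x = (\<Sum>b\<in>B. (x \<bullet> b) *\<^sub>R b)" for x
  proof -
    define y where "y = (\<Sum>b\<in>B. (x \<bullet> b) *\<^sub>R b)"
    have yb: "y \<bullet> b = x \<bullet> b" if "b \<in> B" for b
    proof -
      have "y \<bullet> b = (\<Sum>b'\<in>B. (x \<bullet> b') * (b' \<bullet> b))" by (simp add: y_def inner_sum_left)
      also have "\<dots> = (\<Sum>b'\<in>B. if b' = b then x \<bullet> b else 0)"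
        using that orth unit by (intro sum.cong) auto
      also have "\<dots> = x \<bullet> b" using that fin by simp
      finally show ?thesis .
    qed
    \<comment> \<open>the defect of the expansion is orthogonal to the whole space, hence to itself\<close>
    have "orthogonal (x - y) c" if "c \<in> C" for c
    proof (cases "c = 0")
      case False
      then have "(x - y) \<bullet> n c = 0" using yb[of "n c"] that by (simp add: B_def inner_diff_left)
      then show ?thesis using False by (simp add: n_def orthogonal_def)
    qed (simp add: orthogonal_def)
    then have "orthogonal (x - y) (x - y)"
      using orthogonal_to_span[of "x - y" C "x - y"] C(2) by simp
    then have "x = y" by (simp add: orthogonal_def)
    then show ?thesis by (metis y_def)
  qed
  with fin show ?thesis unfolding frame_def by blast
qed

lemma frame_linear_expansion:
  fixes f :: "'a::real_inner \<Rightarrow> 'b::real_vector"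
  assumes "frame (B::'a set)" "linear f"
  shows "f x = (\<Sum>b\<in>B. (x \<bullet> b) *\<^sub>R f b)"
proof -
  have "f x = f (\<Sum>b\<in>B. (x \<bullet> b) *\<^sub>R b)" using assms(1) by (metis frame_def)
  also have "\<dots> = (\<Sum>b\<in>B. (x \<bullet> b) *\<^sub>R f b)"
    using assms(2) by (simp add: linear_sum linear_cmul)
  finally show ?thesis .
qed

lemma frame_bounded_linear:
  fixes f :: "'a::real_inner \<Rightarrow> 'b::real_normed_vector"
  assumes "frame (B::'a set)" "linear f"
  shows "bounded_linear f"
proof -
  have "bounded_linear (\<lambda>x. \<Sum>b\<in>B. (x \<bullet> b) *\<^sub>R f b)"
    by (intro bounded_linear_sum bounded_linear_scaleR_const bounded_linear_inner_left)
  also have "(\<lambda>x. \<Sum>b\<in>B. (x \<bullet> b) *\<^sub>R f b) = f"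
    by (rule ext) (rule frame_linear_expansion[OF assms, symmetric])
  finally show ?thesis .
qed

text \<open>
Parameter derivatives of a family of linear maps are again linear in the argument. In what follows
\<open>K x v\<close> is only known to be differentiable in \<open>x\<close> for each fixed \<open>v\<close>.
\<close>

lemma family_derivative_expansion:
  fixes K :: "'a::real_normed_vector \<Rightarrow> 'b::real_inner \<Rightarrow> 'c::real_normed_vector"
  assumes B: "frame (B::'b set)" and K': "\<And>v. ((\<lambda>x. K x v) has_derivative K' v) (at x0)"
    and lin: "\<forall>\<^sub>F x in nhds x0. linear (K x)"
  shows "K' v w = (\<Sum>b\<in>B. (v \<bullet> b) *\<^sub>R K' b w)"
proof -
  have D: "((\<lambda>x. \<Sum>b\<in>B. (v \<bullet> b) *\<^sub>R K x b) has_derivative (\<lambda>w. \<Sum>b\<in>B. (v \<bullet> b) *\<^sub>R K' b w)) (at x0)"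
    by (intro has_derivative_sum has_derivative_scaleR_right K')
  have ev: "\<forall>\<^sub>F x in nhds x0. (\<Sum>b\<in>B. (v \<bullet> b) *\<^sub>R K x b) = K x v"
    using lin by eventually_elim (simp add: frame_linear_expansion[OF B, symmetric])
  have "((\<lambda>x. K x v) has_derivative (\<lambda>w. \<Sum>b\<in>B. (v \<bullet> b) *\<^sub>R K' b w)) (at x0)"
    by (rule has_derivative_eventually_cong[OF D ev])
  then show ?thesis using has_derivative_unique[OF K'] by metis
qed

lemma family_derivative_linear:
  fixes K :: "'a::real_normed_vector \<Rightarrow> 'b::real_inner \<Rightarrow> 'c::real_normed_vector"
  assumes B: "frame (B::'b set)" and K': "\<And>v. ((\<lambda>x. K x v) has_derivative K' v) (at x0)"
    and lin: "\<forall>\<^sub>F x in nhds x0. linear (K x)"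
  shows "linear (\<lambda>v. K' v w)"
proof -
  have "linear (\<lambda>v. \<Sum>b\<in>B. (v \<bullet> b) *\<^sub>R K' b w)"
    by (intro bounded_linear.linear bounded_linear_sum bounded_linear_scaleR_const
        bounded_linear_inner_left)
  also have "(\<lambda>v. \<Sum>b\<in>B. (v \<bullet> b) *\<^sub>R K' b w) = (\<lambda>v. K' v w)"
    by (rule ext) (rule family_derivative_expansion[of B K K' x0, OF assms, symmetric])
  finally show ?thesis .
qed

text \<open>
In finite dimension, differentiability in \<open>x\<close> for each fixed vector implies joint
differentiability: the family is a finite sum of products of a coordinate and a fixed-vector value.
\<close>

lemma family_has_derivative:
  fixes K :: "'a::real_normed_vector \<Rightarrow> 'b::real_inner \<Rightarrow> 'c::real_normed_vector"
  assumes B: "frame (B::'b set)" and K': "\<And>v. ((\<lambda>x. K x v) has_derivative K' v) (at x0)"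
    and lin: "\<forall>\<^sub>F x in nhds x0. linear (K x)"
  shows "((\<lambda>p. K (fst p) (snd p)) has_derivative (\<lambda>p. K x0 (snd p) + K' v0 (fst p))) (at (x0, v0))"
proof -
  have K_fst: "((\<lambda>p. K (fst p) b) has_derivative (\<lambda>p. K' b (fst p))) (at (x0, v0))" for b
    by (rule has_derivative_compose[OF has_derivative_fst[OF has_derivative_ident]]) (simp add: K')
  have "((\<lambda>p. \<Sum>b\<in>B. (snd p \<bullet> b) *\<^sub>R K (fst p) b) has_derivative
      (\<lambda>p. \<Sum>b\<in>B. (snd (x0, v0) \<bullet> b) *\<^sub>R K' b (fst p) + (snd p \<bullet> b) *\<^sub>R K (fst (x0, v0)) b)) (at (x0, v0))"
    by (intro has_derivative_sum has_derivative_scaleR K_fst has_derivative_inner_left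
        has_derivative_snd has_derivative_ident)
  moreover have "(\<lambda>p. \<Sum>b\<in>B. (snd (x0, v0) \<bullet> b) *\<^sub>R K' b (fst p) + (snd p \<bullet> b) *\<^sub>R K (fst (x0, v0)) b)
      = (\<lambda>p. K x0 (snd p) + K' v0 (fst p))"
  proof
    fix p :: "'a \<times> 'b"
    have "linear (K x0)" using lin eventually_nhds_x_imp_x by blast
    from frame_linear_expansion[OF B this, of "snd p"]
      family_derivative_expansion[of B K K' x0 v0 "fst p", OF assms]
    show "(\<Sum>b\<in>B. (snd (x0, v0) \<bullet> b) *\<^sub>R K' b (fst p) + (snd p \<bullet> b) *\<^sub>R K (fst (x0, v0)) b)
        = K x0 (snd p) + K' v0 (fst p)"
      by (simp add: sum.distrib)
  qed
  ultimately have D: "((\<lambda>p. \<Sum>b\<in>B. (snd p \<bullet> b) *\<^sub>R K (fst p) b) has_derivative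
      (\<lambda>p. K x0 (snd p) + K' v0 (fst p))) (at (x0, v0))" by simp
  have "filterlim fst (nhds x0) (nhds (x0, v0))"
    using tendsto_fst[OF tendsto_ident_at] filterlim_ident tendsto_fst by fastforce
  then have "\<forall>\<^sub>F p in nhds (x0, v0). linear (K (fst p))"
    using lin unfolding filterlim_iff by blast
  then have ev: "\<forall>\<^sub>F p in nhds (x0, v0). (\<Sum>b\<in>B. (snd p \<bullet> b) *\<^sub>R K (fst p) b) = K (fst p) (snd p)"
    by eventually_elim (simp add: frame_linear_expansion[OF B, symmetric])
  show ?thesis
    by (rule has_derivative_eventually_cong[OF D ev])
qed

lemma family_continuous_on:
  fixes K :: "'a::topological_space \<Rightarrow> 'b::real_inner \<Rightarrow> 'c::real_normed_vector"
  assumes B: "frame (B::'b set)" and "\<And>v. continuous_on S (\<lambda>x. K x v)" "\<And>x. x \<in> S \<Longrightarrow> linear (K x)"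
    and "continuous_on S u"
  shows "continuous_on S (\<lambda>x. K x (u x))"
proof -
  have "continuous_on S (\<lambda>x. \<Sum>b\<in>B. (u x \<bullet> b) *\<^sub>R K x b)"
    by (intro continuous_intros assms)
  moreover have "(\<Sum>b\<in>B. (u x \<bullet> b) *\<^sub>R K x b) = K x (u x)" if "x \<in> S" for x
    by (rule frame_linear_expansion[OF B assms(3)[OF that], symmetric])
  ultimately show ?thesis by (simp cong: continuous_on_cong)
qed

lemma frame_Blinfun_apply:
  fixes f :: "'a::real_inner \<Rightarrow> 'b::real_normed_vector"
  assumes "frame (B::'a set)" "linear f"
  shows "blinfun_apply (Blinfun f) = f"
  using bounded_linear_Blinfun_apply[OF frame_bounded_linear[OF assms]] .

text \<open>
In finite dimension a curve of functionals is differentiable as soon as its values on vectors are.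
\<close>

lemma Blinfun_has_vector_derivative:
  fixes q :: "real \<Rightarrow> 'a::real_inner \<Rightarrow> real"
  assumes B: "frame (B::'a set)" and q: "\<And>t. t \<in> S \<Longrightarrow> linear (q t)" and q': "linear q'" and "t0 \<in> S"
    and D: "\<And>v. ((\<lambda>t. q t v) has_vector_derivative q' v) (at t0 within S)"
  shows "((\<lambda>t. Blinfun (q t)) has_vector_derivative Blinfun q') (at t0 within S)"
proof -
  define e where "e b = Blinfun (\<lambda>x::'a. x \<bullet> b)" for b
  have exp: "Blinfun f = (\<Sum>b\<in>B. f b *\<^sub>R e b)" if "linear f" for f :: "'a \<Rightarrow> real"
  proof (rule blinfun_eqI)
    fix x
    show "blinfun_apply (Blinfun f) x = blinfun_apply (\<Sum>b\<in>B. f b *\<^sub>R e b) x"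
      using frame_linear_expansion[OF B that, of x]
      by (simp add: frame_Blinfun_apply[OF B that] blinfun.sum_left blinfun.scaleR_left e_def
          bounded_linear_Blinfun_apply bounded_linear_inner_left mult.commute)
  qed
  have *: "((\<lambda>t. \<Sum>b\<in>B. q t b *\<^sub>R e b) has_vector_derivative (\<Sum>b\<in>B. q' b *\<^sub>R e b)) (at t0 within S)"
    by (intro has_vector_derivative_sum
        bounded_linear.has_vector_derivative[OF bounded_linear_scaleR_left] D)
  show ?thesis
    by (rule has_vector_derivative_transform[OF \<open>t0 \<in> S\<close> _ *[folded exp[OF q']]]) (simp add: exp q)
qed

lemma dual_map_apply:
  fixes A :: "'a::real_inner \<Rightarrow> 'b::real_normed_vector"
  assumes "frame (B::'a set)" "linear A"
  shows "blinfun_apply (dual_map A \<phi>) v = blinfun_apply \<phi> (A v)"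
proof -
  have "bounded_linear (\<lambda>v. blinfun_apply \<phi> (A v))"
    by (rule bounded_linear_compose[OF blinfun.bounded_linear_right frame_bounded_linear[OF assms]])
  then show ?thesis by (simp add: dual_map_def bounded_linear_Blinfun_apply)
qed

text \<open>
The decomposition into summands is unique, so the projections inherit linearity from the subspaces.
\<close>

lemma splitting_linear:
  assumes "splitting d d' P P'"
  shows "linear P" "linear P'"
proof -
  have d: "subspace d" "subspace d'" "d \<inter> d' = {0}" "\<And>v. P v \<in> d" "\<And>v. P' v \<in> d'"
    "\<And>v. P v + P' v = v"
    using assms by (auto simp: splitting_def)
  have uniq: "P v = x \<and> P' v = y" if "x \<in> d" "y \<in> d'" "x + y = v" for v x y
  proof -
    have "P v - x = y - P' v" using d(6)[of v] that(3) by (simp add: algebra_simps)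
    moreover have "P v - x \<in> d" "y - P' v \<in> d'" using d that by (auto intro: subspace_diff)
    ultimately have "P v - x = 0" using d(3) by (metis IntI singletonD)
    then show ?thesis using \<open>P v - x = y - P' v\<close> by simp
  qed
  have sum: "P u + P v + (P' u + P' v) = u + v" for u v
    using d(6)[of u] d(6)[of v] by (metis add.assoc add.left_commute)
  have "P (u + v) = P u + P v \<and> P' (u + v) = P' u + P' v" for u v
    by (rule uniq) (use d in \<open>auto intro: subspace_add simp: sum\<close>)
  moreover have "P (c *\<^sub>R v) = c *\<^sub>R P v \<and> P' (c *\<^sub>R v) = c *\<^sub>R P' v" for c v
    by (rule uniq) (use d in \<open>auto intro: subspace_scale simp: scaleR_add_right[symmetric]\<close>)
  ultimately show "linear P" "linear P'" by (auto intro: linearI)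
qed

lemma splitting_projections:
  assumes "splitting d d' P P'"
  shows "v \<in> d \<longleftrightarrow> P' v = 0" "v \<in> d' \<longleftrightarrow> P v = 0"
proof -
  have d: "subspace d" "subspace d'" "d \<inter> d' = {0}" "P v \<in> d" "P' v \<in> d'" "P v + P' v = v"
    using assms by (auto simp: splitting_def)
  have "P' v = v - P v" "P v = v - P' v" using d(6) by (simp_all add: algebra_simps)
  then show "v \<in> d \<longleftrightarrow> P' v = 0" "v \<in> d' \<longleftrightarrow> P v = 0"
    using d by (metis IntI add.right_neutral add.left_neutral singletonD subspace_diff)+
qed

text \<open>
A functional vanishing on both summands of a splitting vanishes.
\<close>

lemma Ann_complement:
  assumes "splitting d d' P P'" "\<phi> \<in> Ann d"
  shows "\<phi> \<in> Ann d' \<longleftrightarrow> \<phi> \<in> Ann UNIV"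
proof
  assume "\<phi> \<in> Ann d'"
  have "blinfun_apply \<phi> v = 0" for v
  proof -
    have "P v \<in> d" "P' v \<in> d'" "P v + P' v = v" using assms(1) by (auto simp: splitting_def)
    then show ?thesis using \<open>\<phi> \<in> Ann d'\<close> assms(2) blinfun.add_right[of \<phi> "P v" "P' v"] by (simp add: Ann_def)
  qed
  then show "\<phi> \<in> Ann UNIV" by (simp add: Ann_def)
qed (simp add: Ann_def)

section \<open>The fundamental lemma of the calculus of variations\<close>

text \<open>
Polynomial test functions suffice: multiplying by \<open>(t - t0) (t1 - t)\<close> makes any polynomial vanish at the
end-points, and by the Weierstrass theorem the remaining factor can approximate \<open>f\<close> times that weight, so that
the weighted function has vanishing square integral.
\<close>

lemma fundamental_lemma_polynomial:
  fixes f :: "real \<Rightarrow> real"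
  assumes "t0 < t1" and f: "continuous_on {t0..t1} f"
    and zero: "\<And>p. real_polynomial_function p \<Longrightarrow> p t0 = 0 \<Longrightarrow> p t1 = 0 \<Longrightarrow>
      integral {t0..t1} (\<lambda>t. p t * f t) = 0"
    and "t \<in> {t0..t1}"
  shows "f t = 0"
proof -
  \<comment> \<open>the weight that makes test functions vanish at the end-points\<close>
  define w where "w t = (t - t0) * (t1 - t)" for t
  have w: "real_polynomial_function w"
    unfolding w_def by (intro real_polynomial_function.intros real_polynomial_function_diff
        bounded_linear_ident)
  define g where "g t = w t * f t" for t
  have g: "continuous_on {t0..t1} g"
    unfolding g_def w_def by (intro continuous_intros f)
  have int: "r integrable_on {t0..t1}" if "continuous_on {t0..t1} r" for r :: "real \<Rightarrow> real"
    by (rule integrable_continuous_interval[OF that])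
  have g2: "continuous_on {t0..t1} (\<lambda>t. g t * g t)" by (intro continuous_intros g)
  define C where "C = integral {t0..t1} (\<lambda>t. \<bar>g t\<bar>)"
  have C: "0 \<le> C" unfolding C_def by (intro integral_nonneg int continuous_intros g) auto
  have small: "integral {t0..t1} (\<lambda>t. g t * g t) \<le> e * C" if "0 < e" for e
  proof -
    obtain r where r: "real_polynomial_function r" "\<And>t. t \<in> {t0..t1} \<Longrightarrow> \<bar>g t - r t\<bar> < e"
      using Stone_Weierstrass_real_polynomial_function[OF compact_Icc g \<open>0 < e\<close>] by blast
    have rc: "continuous_on {t0..t1} r"
      using r(1) by (simp add: continuous_on_polymonial_function real_polynomial_function_eq)
    have "integral {t0..t1} (\<lambda>t. (r t * w t) * f t) = 0"
      by (rule zero) (use r(1) w in \<open>auto intro: real_polynomial_function.intros(4)\<close>, simp_all add: w_def)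
    then have "integral {t0..t1} (\<lambda>t. r t * g t) = 0" by (simp add: g_def mult.assoc)
    moreover have "integral {t0..t1} (\<lambda>t. g t * g t - r t * g t) =
        integral {t0..t1} (\<lambda>t. g t * g t) - integral {t0..t1} (\<lambda>t. r t * g t)"
      by (intro integral_diff int continuous_intros g rc)
    moreover have "integral {t0..t1} (\<lambda>t. g t * g t - r t * g t) \<le> integral {t0..t1} (\<lambda>t. e * \<bar>g t\<bar>)"
    proof (intro integral_le int continuous_intros g rc)
      fix t assume t: "t \<in> {t0..t1}"
      have "g t * g t - r t * g t \<le> \<bar>g t - r t\<bar> * \<bar>g t\<bar>"
        by (metis abs_ge_self abs_mult left_diff_distrib)
      also have "\<dots> \<le> e * \<bar>g t\<bar>" using r(2)[OF t] by (intro mult_right_mono) auto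
      finally show "g t * g t - r t * g t \<le> e * \<bar>g t\<bar>" .
    qed
    ultimately show ?thesis by (simp add: C_def)
  qed
  have "integral {t0..t1} (\<lambda>t. g t * g t) \<le> 0"
  proof (rule field_le_epsilon)
    fix e :: real assume e: "0 < e"
    have "integral {t0..t1} (\<lambda>t. g t * g t) \<le> e / (C + 1) * C" using e C by (intro small) auto
    also have "\<dots> \<le> e" using e C by (simp add: divide_simps)
    finally show "integral {t0..t1} (\<lambda>t. g t * g t) \<le> 0 + e" by simp
  qed
  moreover have "0 \<le> integral {t0..t1} (\<lambda>t. g t * g t)" by (intro integral_nonneg int g2) auto
  ultimately have "((\<lambda>t. g t * g t) has_integral 0) (cbox t0 t1)"
    using int[OF g2] by (metis antisym box_real(2) integrable_integral)
  then have g0: "g s = 0" if "s \<in> {t0..t1}" for s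
    using has_integral_0_cbox_imp_0[of t0 t1 "\<lambda>t. g t * g t" s] g2 that \<open>t0 < t1\<close>
    by auto
  have interior: "f s = 0" if "s \<in> {t0<..<t1}" for s
    using g0[of s] that by (auto simp: g_def w_def)
  show ?thesis
    using continuous_constant_on_closure[of "{t0<..<t1}" f 0 t] interior f assms(1,4)
    by (simp add: closure_greaterThanLessThan)
qed

section \<open>Lie groups in charts\<close>

text \<open>
A smooth curve is described chart by chart on relatively open pieces of its interval; near a given
time such a piece may be replaced by the whole interval.
\<close>

lemma smooth_curve_has_vector_derivative:
  fixes M :: "('m, 'f::real_normed_vector, 'z) charted_scheme"
  assumes c: "smooth_curve M J c" and t: "t \<in> J" "c t \<in> cdom M p"
  shows "((coord M p \<circ> c) has_vector_derivative vector_derivative (coord M p \<circ> c) (at t within J)) (at t within J)"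
    and "\<forall>\<^sub>F s in at t within J. c s \<in> cdom M p"
proof -
  let ?S = "J \<inter> c -` cdom M p"
  obtain U where U: "open U" "?S = J \<inter> U"
    using c unfolding smooth_curve_def openin_open by blast
  have tU: "t \<in> U" using t U(2) by auto
  have at: "at t within ?S = at t within J"
    unfolding U(2) by (rule at_within_nhd[OF tU U(1)]) auto
  have "times_differentiable_on (Suc 0) ?S (coord M p \<circ> c)"
    using c unfolding smooth_curve_def smooth_on_def by blast
  then have "(coord M p \<circ> c) differentiable (at t within ?S)"
    using t by simp
  then have "(coord M p \<circ> c) differentiable (at t within J)"
    by (simp only: at)
  then show "((coord M p \<circ> c) has_vector_derivative vector_derivative (coord M p \<circ> c) (at t within J)) (at t within J)"
    by (simp add: vector_derivative_works)
  have "\<forall>\<^sub>F s in at t within J. s \<in> J \<inter> U"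
    using U(1) tU by (auto simp: eventually_at_topological)
  then show "\<forall>\<^sub>F s in at t within J. c s \<in> cdom M p"
    by (rule eventually_mono) (use U(2) in blast)
qed

locale lie_group_charts =
  fixes G :: "('h, 'e::real_inner) lie_data"
  assumes lie_group: "lie_group G"
begin

abbreviation mult (infixl "\<odot>" 70) where "g \<odot> k \<equiv> gmult G g k"
abbreviation one where "one \<equiv> gone G"
abbreviation x_of where "x_of p \<equiv> coord G p"
abbreviation pt where "pt p \<equiv> param G p"
abbreviation TG where "TG \<equiv> tangent_bundle G"

lemma group: "Groups.group (gmult G) (gone G) (ginv G)"
  and manifold: "smooth_manifold G"
  and smooth_mult: "smooth_map (prod_manifold G G) G (\<lambda>(g, k). g \<odot> k)"
  and smooth_inv: "smooth_map G G (ginv G)"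
  using lie_group by (auto simp: lie_group_def)

sublocale grp: Groups.group "gmult G" "gone G" "ginv G" by (rule group)

lemma mult_one [simp]: "g \<odot> one = g" by (rule grp.right_neutral)

lemma chart_self: "p \<in> cdom G p" and chart_inj: "inj_on (x_of p) (cdom G p)"
  using manifold by (auto simp: smooth_manifold_def)

definition B :: "'e set" where "B = (SOME B. frame B)"

lemma frame_B: "frame B"
proof -
  obtain A :: "'e set" where "finite A" "span A = UNIV"
    using manifold unfolding smooth_manifold_def by blast
  then have "\<exists>B::'e set. frame B" by (rule frame_exists)
  then show ?thesis unfolding B_def by (rule someI_ex)
qed

definition chart_range :: "'h \<Rightarrow> 'e set" where "chart_range p = x_of p ` cdom G p"

lemma pt_x_of [simp]: "a \<in> cdom G p \<Longrightarrow> pt p (x_of p a) = a"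
  by (simp add: param_def inv_into_f_f chart_inj)

lemma x_of_pt [simp]: "x \<in> chart_range p \<Longrightarrow> x_of p (pt p x) = x"
  by (simp add: param_def chart_range_def f_inv_into_f)

lemma pt_in: "x \<in> chart_range p \<Longrightarrow> pt p x \<in> cdom G p"
  by (simp add: param_def chart_range_def inv_into_into)

lemma x_of_in: "a \<in> cdom G p \<Longrightarrow> x_of p a \<in> chart_range p"
  by (simp add: chart_range_def)

definition overlap :: "'h \<Rightarrow> 'h \<Rightarrow> 'e set" where
  "overlap p q = {x \<in> chart_range p. pt p x \<in> cdom G q}"

lemma overlap_eq: "overlap p q = x_of p ` (cdom G p \<inter> cdom G q)"
  unfolding overlap_def using pt_in by (force simp: chart_range_def)

lemma open_overlap: "open (overlap p q)"
  and smooth_transition: "smooth_on (overlap p q) (x_of q \<circ> pt p)"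
  using manifold unfolding overlap_eq smooth_manifold_def by auto

lemma overlap_self: "overlap p p = chart_range p"
  by (auto simp: overlap_def pt_in)

lemma open_chart_range: "open (chart_range p)"
  using open_overlap[of p p] by (simp add: overlap_self)

definition mult_dom :: "'h \<Rightarrow> 'h \<Rightarrow> 'h \<Rightarrow> ('e \<times> 'e) set" where
  "mult_dom p q r = {(x, y). x \<in> chart_range p \<and> y \<in> chart_range q \<and> pt p x \<odot> pt q y \<in> cdom G r}"

definition mult_chart :: "'h \<Rightarrow> 'h \<Rightarrow> 'h \<Rightarrow> 'e \<times> 'e \<Rightarrow> 'e" where
  "mult_chart p q r = (\<lambda>(x, y). x_of r (pt p x \<odot> pt q y))"

lemma open_mult_dom: "open (mult_dom p q r)"
  and smooth_mult_chart: "smooth_on (mult_dom p q r) (mult_chart p q r)"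
proof -
  let ?M = "prod_manifold G G"
  let ?D = "coord ?M (p, q) ` (cdom ?M (p, q) \<inter> (\<lambda>(g, k). g \<odot> k) -` cdom G r)"
  have D: "?D = mult_dom p q r"
  proof
    show "?D \<subseteq> mult_dom p q r"
      by (auto simp: prod_manifold_def mult_dom_def x_of_in)
    show "mult_dom p q r \<subseteq> ?D"
    proof
      fix z assume "z \<in> mult_dom p q r"
      then obtain x y where z: "z = (x, y)" "x \<in> chart_range p" "y \<in> chart_range q" "pt p x \<odot> pt q y \<in> cdom G r"
        by (auto simp: mult_dom_def)
      show "z \<in> ?D"
        by (rule image_eqI[of _ _ "(pt p x, pt q y)"]) (use z in \<open>auto simp: prod_manifold_def pt_in\<close>)
    qed
  qed
  have "param ?M (p, q) (x, y) = (pt p x, pt q y)" if "x \<in> chart_range p" "y \<in> chart_range q" for x y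
    unfolding param_def
  proof (rule inv_into_f_eq)
    show "inj_on (coord ?M (p, q)) (cdom ?M (p, q))"
      using chart_inj by (auto simp: prod_manifold_def inj_on_def)
  qed (use that in \<open>auto simp: prod_manifold_def pt_in param_def[symmetric]\<close>)
  then have "(x_of r \<circ> (\<lambda>(g, k). g \<odot> k) \<circ> param ?M (p, q)) z = mult_chart p q r z" if "z \<in> mult_dom p q r" for z
    using that by (auto simp: mult_dom_def mult_chart_def)
  moreover have "open ?D \<and> smooth_on ?D (x_of r \<circ> (\<lambda>(g, k). g \<odot> k) \<circ> param ?M (p, q))"
    using smooth_mult unfolding smooth_map_def by blast
  ultimately show "open (mult_dom p q r)" "smooth_on (mult_dom p q r) (mult_chart p q r)"
    unfolding D using smooth_on_cong by blast+
qed

lemma mult_chart_has_derivative: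
  "z \<in> mult_dom p q r \<Longrightarrow> (mult_chart p q r has_derivative frechet_derivative (mult_chart p q r) (at z)) (at z)"
  by (rule smooth_on_imp_has_derivative[OF smooth_mult_chart open_mult_dom])

lemma mult_chart_derivative_linear: "z \<in> mult_dom p q r \<Longrightarrow> linear (frechet_derivative (mult_chart p q r) (at z))"
  using mult_chart_has_derivative has_derivative_linear by blast

definition inv_dom :: "'h \<Rightarrow> 'h \<Rightarrow> 'e set" where
  "inv_dom p q = {x \<in> chart_range p. ginv G (pt p x) \<in> cdom G q}"

lemma open_inv_dom: "open (inv_dom p q)"
  and smooth_inv_chart: "smooth_on (inv_dom p q) (x_of q \<circ> ginv G \<circ> pt p)"
proof -
  have "x_of p ` (cdom G p \<inter> ginv G -` cdom G q) = inv_dom p q"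
    unfolding inv_dom_def using pt_in by (force simp: chart_range_def)
  then show "open (inv_dom p q)" "smooth_on (inv_dom p q) (x_of q \<circ> ginv G \<circ> pt p)"
    using smooth_inv unfolding smooth_map_def by metis+
qed

subsection \<open>Differentials of maps in charts\<close>

text \<open>
The condition on a neighbourhood is part of the notion because \<open>param\<close> is arbitrary outside the range
of its chart.
\<close>

definition chart_diff :: "'h \<Rightarrow> 'h \<Rightarrow> ('h \<Rightarrow> 'h) \<Rightarrow> 'h \<Rightarrow> bool" where
  "chart_diff p q f a \<longleftrightarrow> a \<in> cdom G p \<and> f a \<in> cdom G q \<and>
     (\<forall>\<^sub>F x in nhds (x_of p a). x \<in> chart_range p \<and> f (pt p x) \<in> cdom G q) \<and>
     (x_of q \<circ> f \<circ> pt p) differentiable (at (x_of p a))"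

definition chart_deriv :: "'h \<Rightarrow> 'h \<Rightarrow> ('h \<Rightarrow> 'h) \<Rightarrow> 'h \<Rightarrow> 'e \<Rightarrow> 'e" where
  "chart_deriv p q f a = frechet_derivative (x_of q \<circ> f \<circ> pt p) (at (x_of p a))"

lemma chart_deriv_works:
  "chart_diff p q f a \<Longrightarrow>
    ((x_of q \<circ> f \<circ> pt p) has_derivative chart_deriv p q f a) (at (x_of p a))"
  by (simp add: chart_diff_def chart_deriv_def frechet_derivative_works)

lemma chart_deriv_linear: "chart_diff p q f a \<Longrightarrow> linear (chart_deriv p q f a)"
  using chart_deriv_works has_derivative_linear by blast

lemma chart_deriv_chain:
  assumes f: "chart_diff p q f a" and g: "chart_diff q r g (f a)"
  shows "chart_deriv p r (g \<circ> f) a v = chart_deriv q r g (f a) (chart_deriv p q f a v)"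
proof -
  let ?F = "x_of q \<circ> f \<circ> pt p" and ?H = "x_of r \<circ> g \<circ> pt q"
  have Fa: "?F (x_of p a) = x_of q (f a)" using f by (simp add: chart_diff_def)
  have "(?H \<circ> ?F has_derivative chart_deriv q r g (f a) \<circ> chart_deriv p q f a) (at (x_of p a))"
    using diff_chain_at[OF chart_deriv_works[OF f]] chart_deriv_works[OF g] Fa by metis
  moreover have ev: "\<forall>\<^sub>F x in nhds (x_of p a). (?H \<circ> ?F) x = (x_of r \<circ> (g \<circ> f) \<circ> pt p) x"
  proof -
    have "\<forall>\<^sub>F x in nhds (x_of p a). x \<in> chart_range p \<and> f (pt p x) \<in> cdom G q"
      using f by (simp add: chart_diff_def)
    then show ?thesis by eventually_elim simp
  qed
  ultimately have "((x_of r \<circ> (g \<circ> f) \<circ> pt p) has_derivative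
      chart_deriv q r g (f a) \<circ> chart_deriv p q f a) (at (x_of p a))"
    by (rule has_derivative_eventually_cong)
  then show ?thesis unfolding chart_deriv_def[of p r] using frechet_derivative_at by (metis comp_apply)
qed

lemma chart_diff_id:
  assumes "a \<in> cdom G p" "a \<in> cdom G q"
  shows "chart_diff p q id a"
proof -
  have a: "x_of p a \<in> overlap p q" using assms by (auto simp: overlap_eq)
  have "\<forall>\<^sub>F x in nhds (x_of p a). x \<in> overlap p q"
    using a open_overlap eventually_nhds by blast
  moreover have "(x_of q \<circ> pt p) differentiable (at (x_of p a))"
    using smooth_on_imp_has_derivative[OF smooth_transition open_overlap a]
    by (auto simp: differentiable_def)
  ultimately show ?thesis using assms by (simp add: chart_diff_def overlap_def)
qed

lemma chart_deriv_id:
  assumes "a \<in> cdom G p"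
  shows "chart_deriv p p id a v = v"
proof -
  have ev: "\<forall>\<^sub>F x in nhds (x_of p a). x \<in> chart_range p"
    using open_chart_range x_of_in[OF assms] eventually_nhds by blast
  have "((\<lambda>x. x) has_derivative (\<lambda>x. x)) (at (x_of p a))" by (rule has_derivative_ident)
  then have "((x_of p \<circ> id \<circ> pt p) has_derivative (\<lambda>x. x)) (at (x_of p a))"
    by (rule has_derivative_eventually_cong) (use ev in \<open>rule eventually_mono, simp\<close>)
  then show ?thesis unfolding chart_deriv_def using frechet_derivative_at by metis
qed

text \<open>
The chart at \<open>s\<close> for the translating element is arbitrary, so the derivative of left translation by
\<open>g\<close> is seen to depend smoothly on \<open>g\<close>.
\<close>

lemma left_translation_chart:
  assumes "g \<in> cdom G s" "a \<in> cdom G p" "g \<odot> a \<in> cdom G q"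
  shows "chart_diff p q (gmult G g) a"
    and "chart_deriv p q (gmult G g) a v = frechet_derivative (mult_chart s p q) (at (x_of s g, x_of p a)) (0, v)"
proof -
  have z: "(x_of s g, x_of p a) \<in> mult_dom s p q"
    using assms by (simp add: mult_dom_def x_of_in)
  have pair: "((\<lambda>y. (x_of s g, y)) has_derivative (\<lambda>v. (0, v))) (at (x_of p a))"
    by (intro has_derivative_Pair has_derivative_const has_derivative_ident)
  have eq: "x_of q \<circ> gmult G g \<circ> pt p = (\<lambda>y. mult_chart s p q (x_of s g, y))"
    using assms by (auto simp: mult_chart_def)
  have D: "((x_of q \<circ> gmult G g \<circ> pt p) has_derivative
      (\<lambda>v. frechet_derivative (mult_chart s p q) (at (x_of s g, x_of p a)) (0, v))) (at (x_of p a))"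
    unfolding eq by (rule has_derivative_compose[OF pair mult_chart_has_derivative[OF z]])
  have "filterlim (\<lambda>y. (x_of s g, y)) (nhds (x_of s g, x_of p a)) (nhds (x_of p a))"
    by (intro tendsto_Pair tendsto_const filterlim_ident)
  moreover have "\<forall>\<^sub>F z in nhds (x_of s g, x_of p a). z \<in> mult_dom s p q"
    using z open_mult_dom eventually_nhds by blast
  ultimately have "\<forall>\<^sub>F y in nhds (x_of p a). (x_of s g, y) \<in> mult_dom s p q"
    unfolding filterlim_iff by blast
  then have "\<forall>\<^sub>F y in nhds (x_of p a). y \<in> chart_range p \<and> g \<odot> pt p y \<in> cdom G q"
    by eventually_elim (use assms(1) in \<open>auto simp: mult_dom_def\<close>)
  with D assms show "chart_diff p q (gmult G g) a"
    by (auto simp: chart_diff_def differentiable_def)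
  show "chart_deriv p q (gmult G g) a v = frechet_derivative (mult_chart s p q) (at (x_of s g, x_of p a)) (0, v)"
    unfolding chart_deriv_def using frechet_derivative_at[OF D] by metis
qed

subsection \<open>The left trivialization in charts\<close>

lemma TG_coord: "coord TG (p, v) (q, w) = (x_of p q, chart_deriv q p id q w)"
  by (simp add: tangent_bundle_def chart_deriv_def)

lemma TG_cdom: "cdom TG (p, v) = cdom G p \<times> UNIV"
  by (simp add: tangent_bundle_def)

lemma left_triv_eq: "left_triv G (g, \<zeta>) = (g, chart_deriv one g (gmult G g) one \<zeta>)"
  by (simp add: left_triv_def tangent_map_def chart_deriv_def)

text \<open>
\<open>left_field p r x \<zeta>\<close>, written \<open>A(x) \<zeta>\<close> in comments when \<open>p = r\<close>, is
the velocity, in the chart at \<open>r\<close>, of the left-invariant vector field with value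
\<open>\<zeta>\<close> at the identity; its argument \<open>x\<close> is the base point in the chart at \<open>p\<close>. As a partial derivative of
the multiplication it is smooth in \<open>x\<close>.
\<close>

definition left_field :: "'h \<Rightarrow> 'h \<Rightarrow> 'e \<Rightarrow> 'e \<Rightarrow> 'e" where
  "left_field p r x \<zeta> = frechet_derivative (mult_chart p one r) (at (x, x_of one one)) (0, \<zeta>)"

lemma overlap_iff_mult_dom: "x \<in> overlap p r \<longleftrightarrow> (x, x_of one one) \<in> mult_dom p one r"
  using chart_self by (auto simp: overlap_def mult_dom_def x_of_in)

lemma left_field_chart_deriv:
  assumes "g \<in> cdom G p" "g \<in> cdom G r"
  shows "left_field p r (x_of p g) \<zeta> = chart_deriv one r (gmult G g) one \<zeta>"
  using left_translation_chart(2)[OF assms(1) chart_self, of one r] assms(2)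
  by (simp add: left_field_def)

text \<open>
For \<open>p = r\<close>, the left trivialization in the induced chart of the tangent bundle is
\<open>(x, \<zeta>) \<mapsto> (x, A(x) \<zeta>)\<close>; a second chart \<open>p\<close> for the base point is needed to move \<open>x\<close> along a line of one chart
while reading velocities in another.
\<close>

lemma TG_coord_left_triv:
  assumes "g \<in> cdom G p" "g \<in> cdom G r"
  shows "coord TG (r, v) (left_triv G (g, \<zeta>)) = (x_of r g, left_field p r (x_of p g) \<zeta>)"
proof -
  have L: "chart_diff one g (gmult G g) one"
    using left_translation_chart(1)[OF chart_self chart_self, of g one g] chart_self[of g] by simp
  have "chart_deriv g r id (g \<odot> one) (chart_deriv one g (gmult G g) one \<zeta>) =
      chart_deriv one r (id \<circ> gmult G g) one \<zeta>"
    by (rule chart_deriv_chain[OF L, symmetric]) (use chart_diff_id[OF chart_self assms(2)] in simp)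
  then show ?thesis
    by (simp add: left_triv_eq TG_coord left_field_chart_deriv[OF assms])
qed

lemma left_field_linear: "x \<in> overlap p r \<Longrightarrow> linear (left_field p r x)"
proof -
  assume "x \<in> overlap p r"
  then have "linear (frechet_derivative (mult_chart p one r) (at (x, x_of one one)))"
    using mult_chart_derivative_linear overlap_iff_mult_dom by blast
  from linear_add[OF this, of "(0, _)" "(0, _)"] linear_cmul[OF this, of _ "(0, _)"]
  show ?thesis by (intro linearI) (simp_all add: left_field_def)
qed

lemma left_field_has_derivative:
  assumes "x \<in> overlap p r"
  shows "((\<lambda>x. left_field p r x \<zeta>) has_derivative
    (\<lambda>w. frechet_derivative (\<lambda>z. frechet_derivative (mult_chart p one r) (at z) (0, \<zeta>)) (at (x, x_of one one)) (w, 0))) (at x)"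
  unfolding left_field_def
proof (rule has_derivative_compose[of "\<lambda>x. (x, x_of one one)"])
  show "((\<lambda>x. (x, x_of one one)) has_derivative (\<lambda>w. (w, 0))) (at x)"
    by (intro has_derivative_Pair has_derivative_const has_derivative_ident)
  show "((\<lambda>z. frechet_derivative (mult_chart p one r) (at z) (0, \<zeta>)) has_derivative
     frechet_derivative (\<lambda>z. frechet_derivative (mult_chart p one r) (at z) (0, \<zeta>)) (at (x, x_of one one)))
     (at (x, x_of one one))"
    using assms overlap_iff_mult_dom
    by (intro smooth_on_imp_has_derivative[OF smooth_on_directional_derivative[OF smooth_mult_chart open_mult_dom] open_mult_dom])
      blast
qed

definition d_left_field :: "'h \<Rightarrow> 'e \<Rightarrow> 'e \<Rightarrow> 'e \<Rightarrow> 'e" where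
  "d_left_field p \<zeta> x = frechet_derivative (\<lambda>x. left_field p p x \<zeta>) (at x)"

lemma d_left_field_has_derivative:
  "x \<in> chart_range p \<Longrightarrow> ((\<lambda>x. left_field p p x \<zeta>) has_derivative d_left_field p \<zeta> x) (at x)"
  unfolding d_left_field_def using left_field_has_derivative[of x p p] overlap_self
  by (metis differentiableI frechet_derivative_works)

lemma eventually_chart_range: "x \<in> chart_range p \<Longrightarrow> \<forall>\<^sub>F x in nhds x. x \<in> chart_range p"
  using open_chart_range eventually_nhds by blast

lemma eventually_left_field_linear:
  "x \<in> chart_range p \<Longrightarrow> \<forall>\<^sub>F x in nhds x. linear (left_field p p x)"
  by (rule eventually_mono[OF eventually_chart_range]) (auto intro: left_field_linear simp: overlap_self)

lemma left_field_joint_derivative: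
  assumes "x \<in> chart_range p"
  shows "((\<lambda>z. left_field p p (fst z) (snd z)) has_derivative
    (\<lambda>z. left_field p p x (snd z) + d_left_field p \<zeta> x (fst z))) (at (x, \<zeta>))"
  by (rule family_has_derivative[OF frame_B]) (intro d_left_field_has_derivative eventually_left_field_linear assms)+

text \<open>
The inverse of \<open>A(x)\<close>, as the derivative of left translation by the inverse element. In this
form its differentiability in \<open>x\<close> follows from smoothness of multiplication and inversion.
\<close>

definition left_field_inv :: "'h \<Rightarrow> 'e \<Rightarrow> 'e \<Rightarrow> 'e" where
  "left_field_inv p x u = chart_deriv p one (gmult G (ginv G (pt p x))) (pt p x) u"

lemma left_inverse_translation:
  "gmult G (ginv G g) \<circ> gmult G g = id" "gmult G g \<circ> gmult G (ginv G g) = id"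
  by (auto simp: fun_eq_iff grp.assoc[symmetric])

lemma left_field_inverse:
  assumes "x \<in> chart_range p"
  shows "left_field_inv p x (left_field p p x \<zeta>) = \<zeta>" "left_field p p x (left_field_inv p x u) = u" "linear (left_field_inv p x)"
proof -
  define g where "g = pt p x"
  have g: "g \<in> cdom G p" "x = x_of p g" using assms by (simp_all add: g_def pt_in)
  have 1: "chart_diff one p (gmult G g) one"
    using left_translation_chart(1)[OF chart_self chart_self, of g one p] g by simp
  have 2: "chart_diff p one (gmult G (ginv G g)) g"
    using left_translation_chart(1)[OF chart_self g(1), of "ginv G g" one] chart_self by simp
  have left_field: "left_field p p x = chart_deriv one p (gmult G g) one"
    using left_field_chart_deriv[OF g(1) g(1)] g(2) by auto
  have left_field_inv: "left_field_inv p x = chart_deriv p one (gmult G (ginv G g)) g"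
    by (auto simp: left_field_inv_def g_def)
  show "left_field_inv p x (left_field p p x \<zeta>) = \<zeta>"
    using chart_deriv_chain[OF 1, of one "gmult G (ginv G g)" \<zeta>] 2
    by (simp add: left_field left_field_inv left_inverse_translation chart_deriv_id chart_self)
  show "left_field p p x (left_field_inv p x u) = u"
    using chart_deriv_chain[OF 2, of p "gmult G g" u] 1 g(1)
    by (simp add: left_field left_field_inv left_inverse_translation chart_deriv_id chart_self)
  show "linear (left_field_inv p x)" unfolding left_field_inv using chart_deriv_linear[OF 2] .
qed

lemma left_field_inv_differentiable:
  assumes "x \<in> chart_range p"
  shows "(\<lambda>x. left_field_inv p x u) differentiable (at x)"
proof -
  \<comment> \<open>a chart around the inverse element: the local map is multiplication after inversion in the first argument\<close>
  define q where "q = ginv G (pt p x)"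
  have x: "x \<in> inv_dom p q" using assms chart_self by (auto simp: inv_dom_def q_def)
  let ?i = "x_of q \<circ> ginv G \<circ> pt p"
  let ?F = "\<lambda>z. frechet_derivative (mult_chart q p one) (at z) (0, u)"
  have z: "(?i y, y) \<in> mult_dom q p one" if "y \<in> inv_dom p q" for y
    using that chart_self by (auto simp: inv_dom_def mult_dom_def x_of_in)
  have eq: "?F (?i y, y) = left_field_inv p y u" if "y \<in> inv_dom p q" for y
    using that left_translation_chart(2)[of "ginv G (pt p y)" q "pt p y" p one u] chart_self
    by (simp add: left_field_inv_def inv_dom_def pt_in)
  have i: "(?i has_derivative frechet_derivative ?i (at x)) (at x)"
    by (rule smooth_on_imp_has_derivative[OF smooth_inv_chart open_inv_dom x])
  have F: "(?F has_derivative frechet_derivative ?F (at (?i x, x))) (at (?i x, x))"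
    by (rule smooth_on_imp_has_derivative[OF smooth_on_directional_derivative[OF smooth_mult_chart open_mult_dom]
          open_mult_dom z[OF x]])
  have "((\<lambda>y. ?F (?i y, y)) has_derivative
      (\<lambda>w. frechet_derivative ?F (at (?i x, x)) (frechet_derivative ?i (at x) w, w))) (at x)"
    by (rule has_derivative_compose[OF has_derivative_Pair[OF i has_derivative_ident] F])
  then have "((\<lambda>y. left_field_inv p y u) has_derivative
      (\<lambda>w. frechet_derivative ?F (at (?i x, x)) (frechet_derivative ?i (at x) w, w))) (at x)"
    by (rule has_derivative_transform_within_open[OF _ open_inv_dom x eq])
  then show ?thesis by (auto simp: differentiable_def)
qed

lemma inj_left_triv: "inj (left_triv G)"
proof (rule injI)
  fix a b :: "'h \<times> 'e" assume ab: "left_triv G a = left_triv G b"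
  obtain g \<zeta> g' \<zeta>' where a: "a = (g, \<zeta>)" and b: "b = (g', \<zeta>')" by (metis surj_pair)
  from ab have g': "g' = g" by (simp add: a b left_triv_eq)
  have "left_field g g (x_of g g) \<zeta> = left_field g g (x_of g g) \<zeta>'"
    using ab by (simp add: a b g' left_triv_eq left_field_chart_deriv chart_self)
  then have "\<zeta> = \<zeta>'" using left_field_inverse(1)[OF x_of_in[OF chart_self]] by metis
  then show "a = b" by (simp add: a b g')
qed

lemma inv_left_triv [simp]: "inv (left_triv G) (left_triv G a) = a"
  by (rule inv_f_f[OF inj_left_triv])

lemma inj_TG_coord: "inj_on (coord TG (p, v)) (cdom TG (p, v))"
proof (rule inj_onI)
  fix a b assume ab: "a \<in> cdom TG (p, v)" "b \<in> cdom TG (p, v)" "coord TG (p, v) a = coord TG (p, v) b"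
  obtain q w q' w' where a: "a = (q, w)" and b: "b = (q', w')" by (metis surj_pair)
  have q: "q \<in> cdom G p" "q' = q"
    using ab inj_onD[OF chart_inj, of p q q'] by (simp_all add: a b TG_cdom TG_coord)
  have eq: "chart_deriv q p id q w = chart_deriv q p id q w'" using ab(3) q by (simp add: a b TG_coord)
  have "chart_deriv p q id q (chart_deriv q p id q u) = u" for u
    using chart_deriv_chain[OF chart_diff_id[OF chart_self q(1)], of q id u]
      chart_diff_id[OF q(1) chart_self] by (simp add: chart_deriv_id chart_self)
  then have "w = w'" using eq by metis
  then show "a = b" by (simp add: a b q)
qed

lemma TG_param:
  assumes "x \<in> chart_range p"
  shows "param TG (p, v) (x, u) = left_triv G (pt p x, left_field_inv p x u)"
  unfolding param_def[of TG]
proof (rule inv_into_f_eq[OF inj_TG_coord])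
  show "left_triv G (pt p x, left_field_inv p x u) \<in> cdom TG (p, v)"
    using assms by (simp add: TG_cdom left_triv_eq pt_in)
  show "coord TG (p, v) (left_triv G (pt p x, left_field_inv p x u)) = (x, u)"
    using TG_coord_left_triv[OF pt_in[OF assms] pt_in[OF assms]] assms left_field_inverse(2)[OF assms] by simp
qed

text \<open>
The angular velocity is \<open>(x, u) \<mapsto> A(x)\<^sup>-\<^sup>1 u\<close> in the chart. Its derivative \<open>D\<close> is known
once it is known on the velocities of lifted curves, along which the angular velocity is prescribed.
\<close>

lemma angular_velocity_derivative:
  fixes v0 :: 'e
  assumes x: "x \<in> chart_range p"
  shows "\<exists>D. ((\<lambda>z. snd (inv (left_triv G) (param TG (p, v0) z))) has_derivative D) (at (x, left_field p p x \<eta>)) \<and>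
    (\<forall>w z. D (w, left_field p p x z + d_left_field p \<eta> x w) = z)"
proof -
  let ?\<Theta> = "\<lambda>z. snd (inv (left_triv G) (param TG (p, v0) z))"
  let ?B' = "\<lambda>u. frechet_derivative (\<lambda>x. left_field_inv p x u) (at x)"
  have B': "((\<lambda>x. left_field_inv p x u) has_derivative ?B' u) (at x)" for u
    using left_field_inv_differentiable[OF x] frechet_derivative_works by blast
  have lin: "\<forall>\<^sub>F x in nhds x. linear (left_field_inv p x)"
    using eventually_chart_range[OF x] by (rule eventually_mono) (rule left_field_inverse(3))
  have "((\<lambda>z. left_field_inv p (fst z) (snd z)) has_derivative
      (\<lambda>z. left_field_inv p x (snd z) + ?B' (left_field p p x \<eta>) (fst z))) (at (x, left_field p p x \<eta>))"
    by (rule family_has_derivative[OF frame_B B' lin])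
  then have D: "(?\<Theta> has_derivative
      (\<lambda>z. left_field_inv p x (snd z) + ?B' (left_field p p x \<eta>) (fst z))) (at (x, left_field p p x \<eta>))"
    (is "(_ has_derivative ?D) _")
    by (rule has_derivative_transform_within_open[of _ _ _ _ "chart_range p \<times> UNIV"])
      (use x in \<open>auto simp: TG_param open_chart_range open_Times\<close>)
  have "?D (w, left_field p p x z + d_left_field p \<eta> x w) = z" for w z
  proof -
    \<comment> \<open>along this curve, lifted to the tangent bundle, the angular velocity is \<open>\<eta> + s z\<close>\<close>
    let ?c = "\<lambda>s::real. (x + s *\<^sub>R w, \<eta> + s *\<^sub>R z)"
    let ?f = "\<lambda>y. (fst y, left_field p p (fst y) (snd y))"
    have c: "(?c has_derivative (\<lambda>s. s *\<^sub>R (w, z))) (at 0)"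
      by (auto intro!: derivative_eq_intros)
    have f: "(?f has_derivative (\<lambda>y. (fst y, left_field p p x (snd y) + d_left_field p \<eta> x (fst y)))) (at (?c 0))"
      using left_field_joint_derivative[OF x, of \<eta>]
      by (auto intro!: has_derivative_Pair has_derivative_fst has_derivative_ident)
    have D': "(?\<Theta> has_derivative ?D) (at (?f (?c 0)))" using D by simp
    have "((\<lambda>s. ?\<Theta> (?f (?c s))) has_derivative
        (\<lambda>s. ?D (fst (s *\<^sub>R (w, z)), left_field p p x (snd (s *\<^sub>R (w, z))) + d_left_field p \<eta> x (fst (s *\<^sub>R (w, z)))))) (at 0)"
      by (rule has_derivative_compose[OF has_derivative_compose[OF c f] D'])
    moreover have "((\<lambda>s. ?\<Theta> (?f (?c s))) has_derivative (\<lambda>s. s *\<^sub>R z)) (at 0)"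
    proof (rule has_derivative_transform_within_open)
      show "((\<lambda>s. \<eta> + s *\<^sub>R z) has_derivative (\<lambda>s. s *\<^sub>R z)) (at 0)"
        by (auto intro!: derivative_eq_intros)
      show "open ((\<lambda>s. x + s *\<^sub>R w) -` chart_range p)"
        by (intro open_vimage open_chart_range continuous_intros)
      show "0 \<in> (\<lambda>s. x + s *\<^sub>R w) -` chart_range p" using x by simp
      show "\<eta> + s *\<^sub>R z = ?\<Theta> (?f (?c s))" if "s \<in> (\<lambda>s. x + s *\<^sub>R w) -` chart_range p" for s
        using that by (simp add: TG_param left_field_inverse)
    qed
    ultimately have "(\<lambda>s. ?D (fst (s *\<^sub>R (w, z)), left_field p p x (snd (s *\<^sub>R (w, z))) + d_left_field p \<eta> x (fst (s *\<^sub>R (w, z)))))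
        = (\<lambda>s. s *\<^sub>R z)" by (rule has_derivative_unique)
    from fun_cong[OF this, of 1] show ?thesis by simp
  qed
  with D show ?thesis by blast
qed

section \<open>The Lie bracket\<close>

lemma gmult_one_id: "gmult G one = id"
  by (auto simp: fun_eq_iff)

lemma left_field_one: "left_field one one (x_of one one) \<zeta> = \<zeta>"
  by (simp add: left_field_chart_deriv chart_self gmult_one_id chart_deriv_id)

text \<open>
At the identity the map \<open>A\<close> is the identity, so only its derivative enters the bracket.
\<close>

lemma lie_bracket_eq:
  "lie_bracket G \<xi> \<eta> = d_left_field one \<eta> (x_of one one) \<xi> - d_left_field one \<xi> (x_of one one) \<eta>"
proof -
  have loc: "local_field G one (\<lambda>g. snd (left_triv G (g, \<zeta>))) x = left_field one one x \<zeta>" if "x \<in> chart_range one" for x \<zeta>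
    using TG_coord_left_triv[OF pt_in[OF that] pt_in[OF that], of 0 \<zeta>] that
    by (simp add: local_field_def left_triv_eq)
  have D: "frechet_derivative (local_field G one (\<lambda>g. snd (left_triv G (g, \<zeta>)))) (at (x_of one one))
      = d_left_field one \<zeta> (x_of one one)" for \<zeta>
  proof (rule frechet_derivative_at[symmetric])
    show "(local_field G one (\<lambda>g. snd (left_triv G (g, \<zeta>))) has_derivative d_left_field one \<zeta> (x_of one one)) (at (x_of one one))"
      by (rule has_derivative_transform_within_open[OF d_left_field_has_derivative open_chart_range[of one]])
        (simp_all add: x_of_in chart_self loc)
  qed
  show ?thesis
    by (simp add: lie_bracket_def vf_bracket_def D loc x_of_in chart_self left_field_one)
qed

lemma centre_in_range: "x_of p p \<in> chart_range p"
  by (simp add: x_of_in chart_self)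

lemma d_left_field_linear: "linear (d_left_field p \<zeta> (x_of p p))"
  using d_left_field_has_derivative[OF centre_in_range] has_derivative_linear by blast

lemma d_left_field_family_linear: "linear (\<lambda>\<zeta>. d_left_field p \<zeta> (x_of p p) w)"
  by (rule family_derivative_linear[OF frame_B d_left_field_has_derivative[OF centre_in_range] eventually_left_field_linear[OF centre_in_range]])

lemma lie_bracket_linear: "linear (lie_bracket G \<eta>)" "linear (\<lambda>\<eta>. lie_bracket G \<eta> \<xi>)"
  unfolding lie_bracket_eq[abs_def]
  by (intro linear_compose_sub d_left_field_linear d_left_field_family_linear)+

text \<open>
Translation by \<open>h g\<close> is translation by \<open>g\<close> followed by translation by \<open>h\<close>; here \<open>g\<close> is the point with
coordinate \<open>y\<close>, and the chain rule is applied at the identity.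
\<close>

lemma left_field_translated:
  assumes "y \<in> chart_range one" "h \<odot> pt one y \<in> cdom G h"
  shows "left_field h h (x_of h (h \<odot> pt one y)) \<zeta> =
    frechet_derivative (mult_chart h one h) (at (x_of h h, y)) (0, left_field one one y \<zeta>)"
proof -
  let ?g = "pt one y"
  have g: "?g \<in> cdom G one" "x_of one ?g = y" using assms by (simp_all add: pt_in)
  have comp: "gmult G (h \<odot> ?g) = gmult G h \<circ> gmult G ?g"
    by (auto simp: fun_eq_iff grp.assoc)
  have 1: "chart_diff one one (gmult G ?g) one"
    using left_translation_chart(1)[OF chart_self chart_self, of ?g one one] g by simp
  have 2: "chart_diff one h (gmult G h) ?g"
    and 3: "chart_deriv one h (gmult G h) ?g v = frechet_derivative (mult_chart h one h) (at (x_of h h, y)) (0, v)" for v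
    using left_translation_chart[OF chart_self g(1) assms(2)] g(2) by auto
  have "left_field h h (x_of h (h \<odot> ?g)) \<zeta> = chart_deriv one h (gmult G h \<circ> gmult G ?g) one \<zeta>"
    using left_field_chart_deriv[OF assms(2) assms(2)] by (simp add: comp)
  also have "\<dots> = chart_deriv one h (gmult G h) ?g (chart_deriv one one (gmult G ?g) one \<zeta>)"
    using chart_deriv_chain[OF 1, of h "gmult G h" \<zeta>] 2 by simp
  also have "chart_deriv one one (gmult G ?g) one \<zeta> = left_field one one y \<zeta>"
    using left_field_chart_deriv[OF g(1) g(1), of \<zeta>] g(2) by simp
  finally show ?thesis by (simp add: 3)
qed

text \<open>
The derivative of the preceding identity at the identity element: the derivative of a left-invariant
field transforms like a tensor up to the second derivative of left translation.
\<close>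

lemma d_left_field_translated:
  fixes h :: 'h
  defines "z \<equiv> (x_of h h, x_of one one)"
  shows "d_left_field h \<zeta> (x_of h h) (left_field h h (x_of h h) w) =
    left_field h h (x_of h h) (d_left_field one \<zeta> (x_of one one) w) +
    frechet_derivative (\<lambda>z. frechet_derivative (mult_chart h one h) (at z) (0, \<zeta>)) (at z) (0, w)"
proof -
  let ?x = "x_of h h" and ?e = "x_of one one"
  let ?J = "\<lambda>y v. frechet_derivative (mult_chart h one h) (at (?x, y)) (0, v)"
  let ?H = "\<lambda>v w. frechet_derivative (\<lambda>z. frechet_derivative (mult_chart h one h) (at z) (0, v)) (at z) (0, w)"
  let ?U = "Pair ?x -` mult_dom h one h"
  have U: "open ?U" by (intro open_vimage open_mult_dom continuous_intros)
  have U_iff: "y \<in> ?U \<longleftrightarrow> y \<in> chart_range one \<and> h \<odot> pt one y \<in> cdom G h" for y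
    by (simp add: mult_dom_def centre_in_range chart_self)
  have e: "?e \<in> ?U" using overlap_iff_mult_dom[of ?x h h] centre_in_range by (simp add: overlap_self)
  have pair: "(Pair ?x has_derivative (\<lambda>w. (0, w))) (at y)" for y
    by (intro has_derivative_Pair has_derivative_const has_derivative_ident)
  have J: "((\<lambda>y. ?J y v) has_derivative ?H v) (at ?e)" for v
    using has_derivative_compose[OF pair smooth_on_imp_has_derivative[OF
          smooth_on_directional_derivative[OF smooth_mult_chart open_mult_dom] open_mult_dom], of ?e h one h "(0, v)"] e
    by (simp add: z_def)
  have J_linear: "linear (?J y)" if "y \<in> ?U" for y
    using linear_compose[OF _ mult_chart_derivative_linear, of "Pair 0" "(?x, y)" h one h] that
    by (simp add: o_def linear_iff)
  have J_ev: "\<forall>\<^sub>F y in nhds ?e. linear (?J y)"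
    using U e J_linear eventually_nhds by blast
  have left_field_J: "?J ?e = left_field h h ?x" by (auto simp: left_field_def)
  have J_joint: "((\<lambda>p. ?J (fst p) (snd p)) has_derivative (\<lambda>p. ?J ?e (snd p) + ?H \<zeta> (fst p)))
      (at (?e, left_field one one ?e \<zeta>))"
    using family_has_derivative[OF frame_B J J_ev, of \<zeta>] by (simp only: left_field_one)
  have rhs: "((\<lambda>y. ?J y (left_field one one y \<zeta>)) has_derivative
      (\<lambda>w. left_field h h ?x (d_left_field one \<zeta> ?e w) + ?H \<zeta> w)) (at ?e)"
    using has_derivative_compose[OF has_derivative_Pair[OF has_derivative_ident d_left_field_has_derivative[OF centre_in_range]] J_joint]
    by (simp add: left_field_def[of h h])
  have "(mult_chart h one h has_derivative frechet_derivative (mult_chart h one h) (at (?x, ?e))) (at (?x, ?e))"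
    using mult_chart_has_derivative e by simp
  from has_derivative_compose[OF pair this]
  \<comment> \<open>\<open>A(x)\<close> at the point \<open>h\<close> is the derivative at the identity of left translation by \<open>h\<close>\<close>
  have phi: "((\<lambda>y. x_of h (h \<odot> pt one y)) has_derivative left_field h h ?x) (at ?e)"
    by (simp add: mult_chart_def left_field_J[symmetric] chart_self)
  have "((\<lambda>x. left_field h h x \<zeta>) has_derivative d_left_field h \<zeta> ?x) (at (x_of h (h \<odot> pt one ?e)))"
    using d_left_field_has_derivative[OF centre_in_range] by (simp add: chart_self)
  from has_derivative_compose[OF phi this]
  have "((\<lambda>y. ?J y (left_field one one y \<zeta>)) has_derivative (\<lambda>w. d_left_field h \<zeta> ?x (left_field h h ?x w))) (at ?e)"
    by (rule has_derivative_transform_within_open[OF _ U e]) (use U_iff left_field_translated in auto)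
  from has_derivative_unique[OF this rhs] show ?thesis by meson
qed

text \<open>
The bracket of left-invariant fields is left-invariant, since the second derivative in the
transformation law is symmetric and cancels.
\<close>

lemma bracket_in_chart:
  "left_field h h (x_of h h) (lie_bracket G \<eta> \<xi>) =
    d_left_field h \<xi> (x_of h h) (left_field h h (x_of h h) \<eta>) - d_left_field h \<eta> (x_of h h) (left_field h h (x_of h h) \<xi>)"
proof -
  have "(x_of h h, x_of one one) \<in> mult_dom h one h"
    using overlap_iff_mult_dom[of "x_of h h" h h] centre_in_range by (simp add: overlap_self)
  note sym = second_derivative_symmetric[OF smooth_mult_chart open_mult_dom this, of "(0, \<xi>)" "(0, \<eta>)"]
  have "linear (left_field h h (x_of h h))" by (rule left_field_linear) (simp add: overlap_self centre_in_range)
  then show ?thesis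
    by (simp add: lie_bracket_eq d_left_field_translated sym linear_diff)
qed

section \<open>Admissible variations\<close>

lemma left_triv_own_chart: "left_triv G (h, \<zeta>) = (h, left_field h h (x_of h h) \<zeta>)"
  by (simp add: left_triv_eq left_field_chart_deriv chart_self)

lemma TG_coord_self: "coord TG (h, v) (h, v) = (x_of h h, v)"
  by (simp add: TG_coord chart_deriv_id chart_self)

text \<open>
The derivative of \<open>(x(s), A(x(s)) z(s))\<close> by the product rule.
\<close>

lemma lifted_curve_derivative:
  assumes J: "t \<in> J" and c: "smooth_curve G J h"
    and x': "((x_of (h t) \<circ> h) has_vector_derivative x') (at t within J)"
    and z: "(z has_vector_derivative z') (at t within J)"
  shows "((coord TG (h t, v) \<circ> (\<lambda>s. left_triv G (h s, z s))) has_vector_derivative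
    (x', left_field (h t) (h t) (x_of (h t) (h t)) z' + d_left_field (h t) (z t) (x_of (h t) (h t)) x')) (at t within J)"
proof (rule has_vector_derivative_eventually_cong[OF _ J])
  let ?p = "h t"
  let ?x = "x_of ?p \<circ> h"
  let ?f = "\<lambda>y. (fst y, left_field ?p ?p (fst y) (snd y))"
  let ?D = "\<lambda>y. (fst y, left_field ?p ?p (x_of ?p ?p) (snd y) + d_left_field ?p (z t) (x_of ?p ?p) (fst y))"
  have f: "(?f has_derivative ?D) (at (?x t, z t))"
    using has_derivative_Pair[OF has_derivative_fst[OF has_derivative_ident] left_field_joint_derivative[OF centre_in_range]]
    by simp
  have xz: "((\<lambda>s. (?x s, z s)) has_derivative (\<lambda>r. r *\<^sub>R (x', z'))) (at t within J)"
    using has_vector_derivative_Pair[OF x' z] by (simp add: has_vector_derivative_def)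
  have "((\<lambda>s. ?f (?x s, z s)) has_derivative (\<lambda>r. ?D (r *\<^sub>R (x', z')))) (at t within J)"
    by (rule has_derivative_compose[OF xz f])
  moreover have "linear ?D" using has_derivative_linear[OF f] .
  ultimately show "((\<lambda>s. ?f (?x s, z s)) has_vector_derivative
      (x', left_field ?p ?p (x_of ?p ?p) z' + d_left_field ?p (z t) (x_of ?p ?p) x')) (at t within J)"
    unfolding has_vector_derivative_def linear_cmul[OF \<open>linear ?D\<close>] by simp
  have eq: "?f (?x s, z s) = (coord TG (?p, v) \<circ> (\<lambda>s. left_triv G (h s, z s))) s" if "h s \<in> cdom G ?p" for s
    using TG_coord_left_triv[OF that that] by simp
  show "\<forall>\<^sub>F s in at t within J. ?f (?x s, z s) = (coord TG (?p, v) \<circ> (\<lambda>s. left_triv G (h s, z s))) s"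
    using smooth_curve_has_vector_derivative(2)[OF c J chart_self] by (rule eventually_mono) (rule eq)
  show "?f (?x t, z t) = (coord TG (?p, v) \<circ> (\<lambda>s. left_triv G (h s, z s))) t"
    by (rule eq[OF chart_self])
qed

lemma variation_eq:
  assumes t: "t0 < t1" "t \<in> {t0..t1}" and adm: "admissible_curve G t0 t1 h \<eta>"
    and \<xi>: "(\<xi> has_vector_derivative \<xi>') (at t within {t0..t1})"
  defines "A \<equiv> left_field (h t) (h t) (x_of (h t) (h t))" and "A' \<equiv> \<lambda>\<zeta>. d_left_field (h t) \<zeta> (x_of (h t) (h t))"
  shows "variation G t0 t1 h \<xi> t = ((h t, A (\<eta> t)), (A (\<xi> t), A \<xi>' + A' (\<xi> t) (A (\<eta> t))))"
proof -
  let ?J = "{t0..t1}"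
  have ne: "at t within ?J \<noteq> bot" using perfect_interval[OF t(1)] t(2) by (simp add: perfect_def)
  have h: "smooth_curve G ?J h" using adm by (simp add: admissible_curve_def)
  let ?x' = "vector_derivative (x_of (h t) \<circ> h) (at t within ?J)"
  note x' = smooth_curve_has_vector_derivative(1)[OF h t(2) chart_self]
  have "left_triv G (h t, \<eta> t) = tangent_lift G ?J h t"
    using adm t(2) by (simp add: admissible_curve_def)
  then have "?x' = A (\<eta> t)" by (simp add: left_triv_own_chart tangent_lift_def A_def)
  moreover have "vector_derivative (coord TG (left_triv G (h t, \<xi> t)) \<circ> (\<lambda>s. left_triv G (h s, \<xi> s))) (at t within ?J)
      = (?x', A \<xi>' + A' (\<xi> t) ?x')"
    unfolding A_def A'_def left_triv_own_chart[of "h t"]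
    by (rule vector_derivative_within[OF ne lifted_curve_derivative[OF t(2) h x' \<xi>]])
  ultimately show ?thesis
    by (simp add: variation_def tangent_lift_def canonical_flip_def left_triv_own_chart[of "h t"] A_def)
qed

text \<open>
The variation generated by \<open>\<xi>\<close> changes the angular velocity by \<open>\<xi>' + [\<eta>, \<xi>]\<close>. Here \<open>D\<close> is the
derivative of the angular velocity in the chart of the tangent bundle centred at the base point of the
variation.
\<close>

lemma variation_angular_velocity:
  assumes t: "t0 < t1" "t \<in> {t0..t1}" and adm: "admissible_curve G t0 t1 h \<eta>"
    and \<xi>: "(\<xi> has_vector_derivative \<xi>') (at t within {t0..t1})"
  shows "\<exists>D v. fst (variation G t0 t1 h \<xi> t) = (h t, v) \<and> left_triv G (h t, \<eta> t) = (h t, v) \<and>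
    ((\<lambda>z. snd (inv (left_triv G) (param TG (h t, v) z))) has_derivative D) (at (x_of (h t) (h t), v)) \<and>
    D (snd (variation G t0 t1 h \<xi> t)) = \<xi>' + lie_bracket G (\<eta> t) (\<xi> t)"
proof -
  let ?p = "h t" and ?x = "x_of (h t) (h t)"
  let ?A = "left_field ?p ?p ?x"
  obtain D where D: "((\<lambda>z. snd (inv (left_triv G) (param TG (?p, ?A (\<eta> t)) z))) has_derivative D) (at (?x, ?A (\<eta> t)))"
    "\<And>w z. D (w, ?A z + d_left_field ?p (\<eta> t) ?x w) = z"
    using angular_velocity_derivative[OF centre_in_range] by blast
  have "linear ?A" by (rule left_field_linear) (simp add: overlap_self centre_in_range)
  then have "?A \<xi>' + d_left_field ?p (\<xi> t) ?x (?A (\<eta> t)) =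
      ?A (\<xi>' + lie_bracket G (\<eta> t) (\<xi> t)) + d_left_field ?p (\<eta> t) ?x (?A (\<xi> t))"
    by (simp add: linear_add bracket_in_chart)
  with D show ?thesis
    by (intro exI[of _ D] exI[of _ "?A (\<eta> t)"])
      (simp add: variation_eq[OF assms] left_triv_own_chart)
qed

lemma left_invariant_one: "left_invariant G L \<Longrightarrow> L (g, \<zeta>) = L (one, \<zeta>)"
  by (metis left_invariant_def mult_one)

text \<open>
The transported Lagrangian is the reduced one composed with the angular velocity, and the chain rule
applies.
\<close>

lemma pairing_variation:
  assumes t: "t0 < t1" "t \<in> {t0..t1}" and adm: "admissible_curve G t0 t1 h \<eta>"
    and \<xi>: "(\<xi> has_vector_derivative \<xi>') (at t within {t0..t1})"
    and L: "left_invariant G L" and L': "((\<lambda>\<zeta>. L (one, \<zeta>)) has_derivative L') (at (\<eta> t))"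
  shows "pairing TG (L \<circ> inv (left_triv G)) (variation G t0 t1 h \<xi> t) =
    L' (\<xi>' + lie_bracket G (\<eta> t) (\<xi> t))"
proof -
  obtain D v where D: "fst (variation G t0 t1 h \<xi> t) = (h t, v)" "left_triv G (h t, \<eta> t) = (h t, v)"
    "((\<lambda>z. snd (inv (left_triv G) (param TG (h t, v) z))) has_derivative D) (at (x_of (h t) (h t), v))"
    "D (snd (variation G t0 t1 h \<xi> t)) = \<xi>' + lie_bracket G (\<eta> t) (\<xi> t)"
    using variation_angular_velocity[OF assms(1-4)] by blast
  have "param TG (h t, v) (x_of (h t) (h t), v) = param TG (h t, v) (coord TG (h t, v) (h t, v))"
    by (simp add: TG_coord_self)
  also have "\<dots> = (h t, v)"
    unfolding param_def by (rule inv_into_f_f[OF inj_TG_coord]) (simp add: TG_cdom chart_self)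
  finally have "snd (inv (left_triv G) (param TG (h t, v) (x_of (h t) (h t), v))) = \<eta> t"
    using D(2) by (metis inv_left_triv snd_conv)
  with L' have L'': "((\<lambda>\<zeta>. L (one, \<zeta>)) has_derivative L')
      (at (snd (inv (left_triv G) (param TG (h t, v) (x_of (h t) (h t), v)))))" by simp
  have "L \<circ> inv (left_triv G) \<circ> param TG (h t, v) =
      (\<lambda>z. L (one, snd (inv (left_triv G) (param TG (h t, v) z))))"
  proof
    fix z
    show "(L \<circ> inv (left_triv G) \<circ> param TG (h t, v)) z =
        L (one, snd (inv (left_triv G) (param TG (h t, v) z)))"
      using left_invariant_one[OF L, of "fst (inv (left_triv G) (param TG (h t, v) z))"
          "snd (inv (left_triv G) (param TG (h t, v) z))"] by simp
  qed
  then have "((L \<circ> inv (left_triv G) \<circ> param TG (h t, v)) has_derivative (\<lambda>y. L' (D y))) (at (x_of (h t) (h t), v))"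
    using has_derivative_compose[OF D(3) L''] by simp
  from frechet_derivative_at[OF this]
  have "frechet_derivative (L \<circ> inv (left_triv G) \<circ> param TG (h t, v)) (at (x_of (h t) (h t), v)) = (\<lambda>y. L' (D y))"
    by simp
  moreover obtain w where "variation G t0 t1 h \<xi> t = ((h t, v), w)" using D(1) by (metis prod.collapse)
  ultimately show ?thesis using D(4) by (simp add: pairing_def TG_coord_self)
qed

text \<open>
Curves in \<open>D\<close> are those whose angular velocity stays in \<open>d\<close>. A curve in \<open>D\<close> with the given velocity
therefore forces the change of angular velocity into \<open>d\<close>; conversely, if \<open>v = \<xi>' + [\<eta>, \<xi>]\<close> is
in \<open>d\<close>, the angular velocities \<open>\<eta> + s v\<close> over a straight line of base points in the chart form such a
curve.
\<close>

lemma tangent_to_distribution_iff: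
  assumes t: "t0 < t1" "t \<in> {t0..t1}" and adm: "admissible_curve G t0 t1 h \<eta>"
    and \<xi>: "(\<xi> has_vector_derivative \<xi>') (at t within {t0..t1})"
    and split: "splitting d d' P P'" and \<eta>: "\<eta> t \<in> d"
  shows "variation G t0 t1 h \<xi> t \<in> tangent_vectors_to TG (left_distribution G d) \<longleftrightarrow>
    \<xi>' + lie_bracket G (\<eta> t) (\<xi> t) \<in> d"
proof
  let ?p = "h t" and ?x = "x_of (h t) (h t)" and ?v = "\<xi>' + lie_bracket G (\<eta> t) (\<xi> t)"
  have P': "bounded_linear P'" by (rule frame_bounded_linear[OF frame_B splitting_linear(2)[OF split]])
  {
    assume "variation G t0 t1 h \<xi> t \<in> tangent_vectors_to TG (left_distribution G d)"
    then obtain c \<epsilon> where c: "variation G t0 t1 h \<xi> t = tangent_lift TG {-\<epsilon><..<\<epsilon>} c 0" "\<epsilon> > 0"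
      "smooth_curve TG {-\<epsilon><..<\<epsilon>} c" "c ` {-\<epsilon><..<\<epsilon>} \<subseteq> left_distribution G d"
      unfolding tangent_vectors_to_def by blast
    let ?J = "{-\<epsilon><..<\<epsilon>}"
    have zero: "0 \<in> ?J" using c(2) by simp
    obtain D v where D: "fst (variation G t0 t1 h \<xi> t) = (?p, v)" "left_triv G (?p, \<eta> t) = (?p, v)"
      "((\<lambda>z. snd (inv (left_triv G) (param TG (?p, v) z))) has_derivative D) (at (?x, v))"
      "D (snd (variation G t0 t1 h \<xi> t)) = ?v"
      using variation_angular_velocity[OF assms(1-4)] by blast
    have c0: "c 0 = (?p, v)" using c(1) D(1) by (simp add: tangent_lift_def)
    then have c0': "c 0 \<in> cdom TG (?p, v)" by (simp add: TG_cdom chart_self)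
    let ?X = "coord TG (?p, v) \<circ> c"
    have "snd (variation G t0 t1 h \<xi> t) = vector_derivative ?X (at 0 within ?J)"
      using c(1) c0 by (simp add: tangent_lift_def)
    then have X: "(?X has_vector_derivative snd (variation G t0 t1 h \<xi> t)) (at 0 within ?J)"
      using smooth_curve_has_vector_derivative(1)[OF c(3) zero c0'] by simp
    have D': "((\<lambda>z. snd (inv (left_triv G) (param TG (?p, v) z))) has_derivative D) (at (?X 0))"
      using D(3) by (simp add: c0 TG_coord_self)
    \<comment> \<open>the \<open>d'\<close>-component of the angular velocity vanishes along a curve in \<open>D\<close>\<close>
    let ?\<theta> = "\<lambda>s. P' (snd (inv (left_triv G) (param TG (?p, v) (?X s))))"
    have "(?\<theta> has_derivative (\<lambda>r. P' (D (r *\<^sub>R snd (variation G t0 t1 h \<xi> t))))) (at 0 within ?J)"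
      by (intro bounded_linear.has_derivative[OF P']
          has_derivative_compose[OF X[unfolded has_vector_derivative_def] D'])
    then have \<theta>: "(?\<theta> has_vector_derivative P' ?v) (at 0 within ?J)"
      unfolding has_vector_derivative_def
      by (simp add: linear_cmul[OF has_derivative_linear[OF D(3)]] D(4)
          linear_cmul[OF bounded_linear.linear[OF P']])
    have vanish: "?\<theta> s = 0" if "s \<in> ?J" "c s \<in> cdom TG (?p, v)" for s
    proof -
      have "param TG (?p, v) (?X s) = c s"
        unfolding param_def using inv_into_f_f[OF inj_TG_coord that(2)] by simp
      moreover have "c s \<in> left_distribution G d" using c(4) that(1) by blast
      then obtain g \<zeta> where "c s = left_triv G (g, \<zeta>)" "\<zeta> \<in> d"
        by (auto simp: left_distribution_def)
      ultimately show ?thesis using splitting_projections(1)[OF split] by simp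
    qed
    have "((\<lambda>s. 0) has_vector_derivative P' ?v) (at 0 within ?J)"
    proof (rule has_vector_derivative_eventually_cong[OF \<theta> zero])
      have "\<forall>\<^sub>F s in at 0 within ?J. s \<in> ?J" by (simp add: eventually_at_filter)
      with smooth_curve_has_vector_derivative(2)[OF c(3) zero c0']
      show "\<forall>\<^sub>F s in at 0 within ?J. ?\<theta> s = 0" by eventually_elim (rule vanish)
      show "?\<theta> 0 = 0" by (rule vanish[OF zero c0'])
    qed
    moreover have "at 0 within ?J \<noteq> bot"
      using perfect_open[OF open_greaterThanLessThan[of "- \<epsilon>" \<epsilon>]] zero unfolding perfect_def by blast
    ultimately have "P' ?v = 0"
      using vector_derivative_unique_within[OF _ _ has_vector_derivative_const] by blast
    then show "?v \<in> d" using splitting_projections(1)[OF split] by simp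
  }
  {
    assume v: "?v \<in> d"
    define A where "A = left_field ?p ?p ?x"
    define w where "w = A (\<xi> t)"
    define g where "g s = pt ?p (?x + s *\<^sub>R w)" for s
    define c where "c s = left_triv G (g s, \<eta> t + s *\<^sub>R ?v)" for s
    have "open ((\<lambda>s. ?x + s *\<^sub>R w) -` chart_range ?p)" by (intro open_vimage open_chart_range continuous_intros)
    then obtain \<epsilon> where \<epsilon>: "\<epsilon> > 0" "ball 0 \<epsilon> \<subseteq> (\<lambda>s. ?x + s *\<^sub>R w) -` chart_range ?p"
      using centre_in_range open_contains_ball by (metis (no_types, lifting) add.right_neutral scaleR_zero_left vimageI)
    let ?J = "{-\<epsilon><..<\<epsilon>}"
    have chart_range: "?x + s *\<^sub>R w \<in> chart_range ?p" if "s \<in> ?J" for s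
      using \<epsilon>(2) that by (auto simp: subset_iff dist_real_def)
    have zero: "0 \<in> ?J" using \<epsilon>(1) by simp
    have open_S: "open {s \<in> ?J. ?x + s *\<^sub>R w \<in> overlap ?p q}" for q
    proof -
      have "open (?J \<inter> (\<lambda>s. ?x + s *\<^sub>R w) -` overlap ?p q)"
        by (intro open_Int open_vimage open_overlap continuous_intros open_greaterThanLessThan)
      then show ?thesis by (simp add: Int_def)
    qed
    have g_in: "s \<in> ?J \<Longrightarrow> g s \<in> cdom G q \<longleftrightarrow> ?x + s *\<^sub>R w \<in> overlap ?p q" for s q
      using chart_range by (simp add: g_def overlap_def)
    have smooth_g: "smooth_curve G ?J g"
      unfolding smooth_curve_def
    proof (intro allI conjI)
      fix q
      have S: "?J \<inter> g -` cdom G q = {s \<in> ?J. ?x + s *\<^sub>R w \<in> overlap ?p q}" using g_in by auto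
      show "openin (top_of_set ?J) (?J \<inter> g -` cdom G q)"
        unfolding S using open_S by (intro open_subset) auto
      have "smooth_on {s \<in> ?J. ?x + s *\<^sub>R w \<in> overlap ?p q} (\<lambda>s. (x_of q \<circ> pt ?p) (?x + s *\<^sub>R w))"
        by (rule smooth_on_along_line[OF smooth_transition open_overlap perfect_open[OF open_S]]) auto
      then show "smooth_on (?J \<inter> g -` cdom G q) (x_of q \<circ> g)"
        unfolding S by (simp add: o_def g_def)
    qed
    have smooth_c: "smooth_curve TG ?J c"
      unfolding smooth_curve_def
    proof (intro allI conjI)
      fix a :: "'h \<times> 'e"
      obtain q u where a: "a = (q, u)" by (metis surj_pair)
      let ?S = "{s \<in> ?J. ?x + s *\<^sub>R w \<in> overlap ?p q}"
      note pS = perfect_open[OF open_S]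
      have S: "?J \<inter> c -` cdom TG a = ?S" using g_in by (auto simp: a TG_cdom c_def left_triv_eq)
      show "openin (top_of_set ?J) (?J \<inter> c -` cdom TG a)"
        unfolding S using open_S by (intro open_subset) auto
      have left_field: "smooth_on ?S (\<lambda>s. left_field ?p q (?x + s *\<^sub>R w) \<zeta>)" for \<zeta>
        using smooth_on_along_line[OF smooth_on_directional_derivative[OF smooth_mult_chart open_mult_dom]
            open_mult_dom pS, of q "(?x, x_of one one)" "(w, 0)" ?p one q "(0, \<zeta>)"] overlap_iff_mult_dom
        by (simp add: left_field_def)
      have "smooth_on ?S (\<lambda>s. ((x_of q \<circ> pt ?p) (?x + s *\<^sub>R w),
          left_field ?p q (?x + s *\<^sub>R w) (\<eta> t) + s *\<^sub>R left_field ?p q (?x + s *\<^sub>R w) ?v))"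
        by (intro smooth_on_Pair smooth_on_add smooth_on_scaleR pS left_field
            smooth_on_along_line[OF smooth_transition open_overlap] smooth_on_polynomial
            real_polynomial_function.intros bounded_linear_ident) auto
      moreover have "(coord TG a \<circ> c) s = ((x_of q \<circ> pt ?p) (?x + s *\<^sub>R w),
          left_field ?p q (?x + s *\<^sub>R w) (\<eta> t) + s *\<^sub>R left_field ?p q (?x + s *\<^sub>R w) ?v)" if s: "s \<in> ?S" for s
      proof -
        have "g s \<in> cdom G ?p" "x_of ?p (g s) = ?x + s *\<^sub>R w" "g s \<in> cdom G q"
          using s chart_range g_in by (auto simp: g_def pt_in)
        moreover have "linear (left_field ?p q (?x + s *\<^sub>R w))" using s by (intro left_field_linear) simp
        ultimately show ?thesis
          using TG_coord_left_triv[of "g s" ?p q u "\<eta> t + s *\<^sub>R ?v"]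
          by (simp add: a c_def g_def linear_add linear_cmul)
      qed
      ultimately show "smooth_on (?J \<inter> c -` cdom TG a) (coord TG a \<circ> c)"
        unfolding S by (subst smooth_on_cong)
    qed
    have g0: "g 0 = ?p" by (simp add: g_def chart_self)
    have x': "((x_of (g 0) \<circ> g) has_vector_derivative w) (at 0 within ?J)"
    proof (rule has_vector_derivative_eventually_cong[OF _ zero])
      show "((\<lambda>s. ?x + s *\<^sub>R w) has_vector_derivative w) (at 0 within ?J)"
        by (auto simp: has_vector_derivative_def intro!: derivative_eq_intros)
      have "\<forall>\<^sub>F s in at 0 within ?J. s \<in> ?J" by (simp add: eventually_at_filter)
      then show "\<forall>\<^sub>F s in at 0 within ?J. ?x + s *\<^sub>R w = (x_of (g 0) \<circ> g) s"
      proof eventually_elim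
        case (elim s)
        then have "x_of ?p (g s) = ?x + s *\<^sub>R w" using chart_range[of s] by (simp add: g_def)
        then show ?case by (simp add: g0)
      qed
    qed (use chart_range[OF zero] in \<open>simp add: g0\<close>)
    have z': "((\<lambda>s. \<eta> t + s *\<^sub>R ?v) has_vector_derivative ?v) (at 0 within ?J)"
      by (auto simp: has_vector_derivative_def intro!: derivative_eq_intros)
    have "at (0::real) within ?J \<noteq> bot"
      using perfect_open[OF open_greaterThanLessThan[of "- \<epsilon>" \<epsilon>]] zero unfolding perfect_def by blast
    from vector_derivative_within[OF this lifted_curve_derivative[OF zero smooth_g x' z']]
    have "vector_derivative (coord TG (?p, A (\<eta> t)) \<circ> c) (at 0 within ?J) = (w, A ?v + d_left_field ?p (\<eta> t) ?x w)"
      by (simp add: g0 A_def c_def[abs_def])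
    moreover have "c 0 = (?p, A (\<eta> t))" by (simp add: c_def g0 left_triv_own_chart A_def)
    moreover have "A ?v + d_left_field ?p (\<eta> t) ?x w = A \<xi>' + d_left_field ?p (\<xi> t) ?x (A (\<eta> t))"
    proof -
      have "linear A" unfolding A_def by (rule left_field_linear) (simp add: overlap_self centre_in_range)
      then show ?thesis
        using bracket_in_chart[of ?p "\<eta> t" "\<xi> t"] by (simp add: linear_add w_def A_def)
    qed
    ultimately have "variation G t0 t1 h \<xi> t = tangent_lift TG ?J c 0"
      using variation_eq[OF assms(1-4)] by (simp add: tangent_lift_def A_def w_def)
    moreover have "c ` ?J \<subseteq> left_distribution G d"
      using split \<eta> v by (auto simp: c_def left_distribution_def splitting_def
          intro!: imageI subspace_add subspace_scale)
    ultimately show "variation G t0 t1 h \<xi> t \<in> tangent_vectors_to TG (left_distribution G d)"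
      unfolding tangent_vectors_to_def using \<epsilon>(1) smooth_c by blast
  }
qed

section \<open>Left-invariant Lagrangians\<close>

text \<open>
In a product chart at the identity, the reduced Lagrangian is a slice of the given one.
\<close>

lemma smooth_reduced_lagrangian:
  assumes "smooth_map (prod_manifold G (vec_manifold :: ('e, 'e) charted)) (vec_manifold :: (real, real) charted) L"
  shows "smooth_on UNIV (\<lambda>\<zeta>. L (one, \<zeta>))"
proof -
  let ?V = "vec_manifold :: ('e, 'e) charted" and ?R = "vec_manifold :: (real, real) charted"
  let ?M = "prod_manifold G ?V"
  let ?F = "coord ?R 0 \<circ> L \<circ> param ?M (one, 0)"
  have dom: "cdom ?M (one, 0) = cdom G one \<times> UNIV"
    and coord: "coord ?M (one, 0) = (\<lambda>(x, y). (x_of one x, y))"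
    by (auto simp: prod_manifold_def vec_manifold_def)
  have D: "coord ?M (one, 0) ` (cdom ?M (one, 0) \<inter> L -` cdom ?R 0) = chart_range one \<times> UNIV"
    unfolding dom coord by (auto simp: vec_manifold_def chart_range_def image_iff)
  have "smooth_on (chart_range one \<times> UNIV) ?F"
    using assms unfolding smooth_map_def D[symmetric] by blast
  moreover have "?F (x_of one one, \<zeta>) = L (one, \<zeta>)" for \<zeta>
  proof -
    have "inj_on (coord ?M (one, 0)) (cdom ?M (one, 0))"
      using chart_inj unfolding dom coord by (auto simp: inj_on_def)
    then have "param ?M (one, 0) (coord ?M (one, 0) (one, \<zeta>)) = (one, \<zeta>)"
      unfolding param_def by (rule inv_into_f_f) (simp add: dom chart_self)
    then show ?thesis by (simp add: coord) (simp add: vec_manifold_def)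
  qed
  ultimately show ?thesis
    using smooth_on_slice[of "chart_range one \<times> UNIV" ?F "x_of one one"]
    by (simp add: open_chart_range open_Times centre_in_range)
qed

lemma partial_h_invariant:
  assumes "left_invariant G L"
  shows "partial_h G L g \<zeta> = 0"
proof -
  have "(\<lambda>x. L (pt g x, \<zeta>)) = (\<lambda>_. L (one, \<zeta>))"
    by (rule ext) (rule left_invariant_one[OF assms])
  then show ?thesis
    by (simp add: partial_h_def differential_def pairing_def o_def zero_blinfun_def)
qed

lemma partial_eta_invariant:
  "left_invariant G L \<Longrightarrow> partial_eta L g \<zeta> = Blinfun (frechet_derivative (\<lambda>\<zeta>. L (one, \<zeta>)) (at \<zeta>))"
  using left_invariant_one[of L g] by (simp add: partial_eta_def)

lemma ad_star_apply: "blinfun_apply (ad_star G \<eta> \<phi>) v = blinfun_apply \<phi> (lie_bracket G \<eta> v)"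
  unfolding ad_star_def by (rule dual_map_apply[OF frame_B lie_bracket_linear(1)])

text \<open>
The derivative \<open>p'\<close> is the second derivative of \<open>l\<close> along \<open>\<eta>\<close>, contracted with the velocity of
\<open>\<eta>\<close>; both depend continuously on time.
\<close>

lemma momentum_derivative:
  assumes "smooth_on UNIV l" and J: "perfect J" and \<eta>: "smooth_on J \<eta>"
  shows "\<exists>p'. (\<forall>t\<in>J. ((\<lambda>t. Blinfun (frechet_derivative l (at (\<eta> t))) :: 'e \<Rightarrow>\<^sub>L real) has_vector_derivative p' t) (at t within J)) \<and>
    (\<forall>v. continuous_on J (\<lambda>t. blinfun_apply (p' t) v))"
proof -
  let ?m = "\<lambda>\<zeta> v. frechet_derivative l (at \<zeta>) v"
  let ?H = "\<lambda>v \<zeta> w. frechet_derivative (\<lambda>\<zeta>. ?m \<zeta> v) (at \<zeta>) w"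
  let ?d = "\<lambda>t. vector_derivative \<eta> (at t within J)"
  let ?q = "\<lambda>t v. ?H v (\<eta> t) (?d t)"
  have l1: "(l has_derivative ?m \<zeta>) (at \<zeta>)" for \<zeta>
    by (rule smooth_on_imp_has_derivative[OF assms(1)]) auto
  have m_smooth: "smooth_on UNIV (\<lambda>\<zeta>. ?m \<zeta> v)" for v
    by (rule smooth_on_directional_derivative[OF assms(1)]) auto
  have m1: "((\<lambda>\<zeta>. ?m \<zeta> v) has_derivative ?H v \<zeta>) (at \<zeta>)" for \<zeta> v
    by (rule smooth_on_imp_has_derivative[OF m_smooth]) auto
  have m_linear: "linear (?m \<zeta>)" for \<zeta> using has_derivative_linear[OF l1] .
  have H_linear: "linear (?H v \<zeta>)" for v \<zeta> using has_derivative_linear[OF m1] .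
  have q_linear: "linear (?q t)" for t
    by (rule family_derivative_linear[OF frame_B m1]) (simp add: m_linear)
  have q: "((\<lambda>t. ?m (\<eta> t) v) has_vector_derivative ?q t v) (at t within J)" if "t \<in> J" for t v
    using has_derivative_compose[OF smooth_on_imp_C1(1)[OF J \<eta> that, unfolded has_vector_derivative_def] m1]
    unfolding has_vector_derivative_def linear_cmul[OF H_linear] .
  have "continuous_on J (\<lambda>t. ?q t v)" for v
  proof (rule family_continuous_on[OF frame_B])
    have H_smooth: "smooth_on UNIV (\<lambda>\<zeta>. ?H v \<zeta> w)" for w
      by (rule smooth_on_directional_derivative[OF m_smooth]) auto
    show "continuous_on J (\<lambda>t. ?H v (\<eta> t) w)" for w
      by (rule continuous_on_compose2[OF smooth_on_imp_continuous_on[OF H_smooth]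
            smooth_on_imp_continuous_on[OF \<eta>]]) auto
  qed (use H_linear smooth_on_imp_C1(2)[OF J \<eta>] in auto)
  then show ?thesis
    using Blinfun_has_vector_derivative[OF frame_B m_linear q_linear _ q]
    by (intro exI[of _ "\<lambda>t. Blinfun (?q t)"]) (simp add: frame_Blinfun_apply[OF frame_B q_linear])
qed

end

section \<open>The first variation of the action\<close>

text \<open>
The Lagrangian \<open>\<Lambda>\<close> may depend on time, so that the results apply both to \<open>L\<close> and to \<open>L\<close> with a
multiplier term subtracted. Here \<open>p\<close> is the momentum along the curve and \<open>p'\<close> its derivative.
\<close>

locale left_invariant_action = lie_group_charts G
  for G :: "('h, 'e::real_inner) lie_data" +
  fixes t0 t1 :: real and h :: "real \<Rightarrow> 'h" and \<eta> :: "real \<Rightarrow> 'e"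
    and \<Lambda> :: "real \<Rightarrow> 'h \<times> 'e \<Rightarrow> real" and p p' :: "real \<Rightarrow> 'e \<Rightarrow>\<^sub>L real"
  assumes interval: "t0 < t1"
    and admissible: "admissible_curve G t0 t1 h \<eta>"
    and invariant: "\<And>t. t \<in> {t0..t1} \<Longrightarrow> left_invariant G (\<Lambda> t)"
    and momentum: "\<And>t. t \<in> {t0..t1} \<Longrightarrow> ((\<lambda>\<zeta>. \<Lambda> t (gone G, \<zeta>)) has_derivative blinfun_apply (p t)) (at (\<eta> t))"
    and dp: "\<And>t. t \<in> {t0..t1} \<Longrightarrow> (p has_vector_derivative p' t) (at t within {t0..t1})"
    and cp': "\<And>v. continuous_on {t0..t1} (\<lambda>t. blinfun_apply (p' t) v)"
begin

abbreviation J where "J \<equiv> {t0..t1}"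
abbreviation dot where "dot \<xi> t \<equiv> vector_derivative \<xi> (at t within J)"

text \<open>
The Euler--Poincare expression of the action.
\<close>

definition EL :: "real \<Rightarrow> 'e \<Rightarrow>\<^sub>L real" where
  "EL t = vector_derivative p (at t within J) - ad_star G (\<eta> t) (p t)"

lemma perfect_J: "perfect J"
  by (rule perfect_interval[OF interval])

lemma within_J: "t \<in> J \<Longrightarrow> at t within J \<noteq> bot"
  using perfect_J by (simp add: perfect_def)

lemma EL_apply: "t \<in> J \<Longrightarrow> blinfun_apply (EL t) v = blinfun_apply (p' t) v - blinfun_apply (p t) (lie_bracket G (\<eta> t) v)"
  using vector_derivative_within[OF within_J dp]
  by (simp add: EL_def blinfun.diff_left ad_star_apply)

lemma continuous_p: "continuous_on J p"
  using dp has_vector_derivative_continuous continuous_on_eq_continuous_within by blast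

lemma generator_derivative:
  assumes "\<xi> \<in> generators t0 t1"
  shows "\<And>t. t \<in> J \<Longrightarrow> (\<xi> has_vector_derivative dot \<xi> t) (at t within J)"
    and "continuous_on J (dot \<xi>)" and "continuous_on J \<xi>"
  using assms smooth_on_imp_C1[OF perfect_J, of \<xi>] smooth_on_imp_continuous_on[of J \<xi>]
  by (auto simp: generators_def)

lemma continuous_bracket:
  assumes "continuous_on J u"
  shows "continuous_on J (\<lambda>t. lie_bracket G (\<eta> t) (u t))"
proof (rule family_continuous_on[OF frame_B _ _ assms])
  have "continuous_on J \<eta>"
    using admissible smooth_on_imp_continuous_on by (auto simp: admissible_curve_def)
  then show "continuous_on J (\<lambda>t. lie_bracket G (\<eta> t) v)" for v
    using bounded_linear.continuous_on[OF frame_bounded_linear[OF frame_B lie_bracket_linear(2)]] by blast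
qed (rule lie_bracket_linear)

lemma continuous_EL:
  assumes "continuous_on J u"
  shows "continuous_on J (\<lambda>t. blinfun_apply (EL t) (u t))"
proof (rule family_continuous_on[OF frame_B _ _ assms])
  have "continuous_on J (\<lambda>t. blinfun_apply (p' t) v - blinfun_apply (p t) (lie_bracket G (\<eta> t) v))" for v
    by (intro continuous_intros cp' continuous_p continuous_bracket)
  then show "continuous_on J (\<lambda>t. blinfun_apply (EL t) v)" for v
    by (rule continuous_on_eq) (simp add: EL_apply)
qed (simp add: blinfun.bounded_linear_right bounded_linear.linear)

lemma dS_eq:
  assumes "\<xi> \<in> generators t0 t1"
  shows "dS G t0 t1 \<Lambda> h \<xi> = integral J (\<lambda>t. blinfun_apply (p t) (dot \<xi> t + lie_bracket G (\<eta> t) (\<xi> t)))"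
  unfolding dS_def
  by (intro integral_cong pairing_variation[OF interval _ admissible _ invariant momentum]
      generator_derivative[OF assms])

text \<open>
Integration by parts; the boundary term vanishes because generators do.
\<close>

lemma dS_EL:
  assumes \<xi>: "\<xi> \<in> generators t0 t1"
  shows "dS G t0 t1 \<Lambda> h \<xi> = - integral J (\<lambda>t. blinfun_apply (EL t) (\<xi> t))"
proof -
  let ?P = "\<lambda>t. blinfun_apply (p t) (dot \<xi> t) + blinfun_apply (p' t) (\<xi> t)"
  have "((\<lambda>t. blinfun_apply (p t) (\<xi> t)) has_vector_derivative ?P t) (at t within J)" if "t \<in> J" for t
    by (rule bounded_bilinear.has_vector_derivative[OF bounded_bilinear_blinfun_apply
          dp[OF that] generator_derivative(1)[OF \<xi> that]])
  then have "(?P has_integral blinfun_apply (p t1) (\<xi> t1) - blinfun_apply (p t0) (\<xi> t0)) J"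
    by (intro fundamental_theorem_of_calculus) (use interval in auto)
  then have P: "(?P has_integral 0) J" using \<xi> by (simp add: generators_def blinfun.zero_right)
  have "(\<lambda>t. blinfun_apply (EL t) (\<xi> t)) integrable_on J"
    by (intro integrable_continuous_interval continuous_EL generator_derivative(3)[OF \<xi>])
  then have "((\<lambda>t. ?P t - blinfun_apply (EL t) (\<xi> t)) has_integral 0 - integral J (\<lambda>t. blinfun_apply (EL t) (\<xi> t))) J"
    by (intro has_integral_diff P integrable_integral)
  then have "integral J (\<lambda>t. ?P t - blinfun_apply (EL t) (\<xi> t)) = - integral J (\<lambda>t. blinfun_apply (EL t) (\<xi> t))"
    by (simp add: integral_unique)
  moreover have "integral J (\<lambda>t. ?P t - blinfun_apply (EL t) (\<xi> t)) =
      integral J (\<lambda>t. blinfun_apply (p t) (dot \<xi> t + lie_bracket G (\<eta> t) (\<xi> t)))"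
    by (intro integral_cong) (simp add: EL_apply blinfun.add_right)
  ultimately show ?thesis by (simp add: dS_eq[OF \<xi>])
qed

lemma generators_add:
  "a \<in> generators t0 t1 \<Longrightarrow> b \<in> generators t0 t1 \<Longrightarrow> (\<lambda>t. a t + b t :: 'e) \<in> generators t0 t1"
  by (simp add: generators_def smooth_on_add[OF perfect_J])

lemma dS_add:
  assumes "a \<in> generators t0 t1" "b \<in> generators t0 t1"
  shows "dS G t0 t1 \<Lambda> h (\<lambda>t. a t + b t) = dS G t0 t1 \<Lambda> h a + dS G t0 t1 \<Lambda> h b"
proof -
  have "integral J (\<lambda>t. blinfun_apply (EL t) (a t) + blinfun_apply (EL t) (b t)) =
      integral J (\<lambda>t. blinfun_apply (EL t) (a t)) + integral J (\<lambda>t. blinfun_apply (EL t) (b t))"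
    by (intro integral_add integrable_continuous_interval continuous_EL generator_derivative(3) assms)
  then show ?thesis
    by (simp add: dS_EL generators_add assms blinfun.add_right)
qed

text \<open>
Generators of the form \<open>q(t) v\<close>, with a polynomial \<open>q\<close> and a constant vector \<open>v\<close> of \<open>d\<close>, suffice as
tests.
\<close>

lemma stationary_iff:
  assumes d: "subspace d"
  shows "(\<forall>\<xi>\<in>generators t0 t1. (\<forall>t\<in>J. \<xi> t \<in> d) \<longrightarrow> dS G t0 t1 \<Lambda> h \<xi> = 0) \<longleftrightarrow>
    (\<forall>t\<in>J. EL t \<in> Ann d)"
proof (intro iffI ballI impI)
  fix t assume stat: "\<forall>\<xi>\<in>generators t0 t1. (\<forall>t\<in>J. \<xi> t \<in> d) \<longrightarrow> dS G t0 t1 \<Lambda> h \<xi> = 0" and t: "t \<in> J"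
  have "blinfun_apply (EL t) v = 0" if v: "v \<in> d" for v
  proof (rule fundamental_lemma_polynomial[OF interval _ _ t])
    show "continuous_on J (\<lambda>t. blinfun_apply (EL t) v)"
      by (rule continuous_EL) (rule continuous_on_const)
    fix q :: "real \<Rightarrow> real" assume q: "real_polynomial_function q" "q t0 = 0" "q t1 = 0"
    have \<xi>: "(\<lambda>t. q t *\<^sub>R v) \<in> generators t0 t1"
      using q by (simp add: generators_def smooth_on_scaleR smooth_on_polynomial smooth_on_const perfect_J)
    with stat have "dS G t0 t1 \<Lambda> h (\<lambda>t. q t *\<^sub>R v) = 0"
      using v d by (simp add: subspace_scale)
    then show "integral J (\<lambda>t. q t * blinfun_apply (EL t) v) = 0"
      by (simp add: dS_EL[OF \<xi>] blinfun.scaleR_right)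
  qed
  then show "EL t \<in> Ann d" by (simp add: Ann_def)
next
  fix \<xi> assume "\<forall>t\<in>J. EL t \<in> Ann d" "\<xi> \<in> generators t0 t1" "\<forall>t\<in>J. \<xi> t \<in> d"
  then have "integral J (\<lambda>t. blinfun_apply (EL t) (\<xi> t)) = integral J (\<lambda>t. 0)"
    by (intro integral_cong) (simp add: Ann_def)
  then show "dS G t0 t1 \<Lambda> h \<xi> = 0" by (simp add: dS_EL[OF \<open>\<xi> \<in> generators t0 t1\<close>])
qed

lemma unconstrained_iff:
  "(\<forall>\<xi>\<in>generators t0 t1. dS G t0 t1 \<Lambda> h \<xi> = 0) \<longleftrightarrow> (\<forall>t\<in>J. EL t \<in> Ann UNIV)"
  using stationary_iff[OF subspace_UNIV] by simp

lemma generators_linear: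
  fixes A :: "'e \<Rightarrow> 'e"
  assumes "linear A" "\<xi> \<in> generators t0 t1"
  shows "(\<lambda>t. A (\<xi> t)) \<in> generators t0 t1"
    and "t \<in> J \<Longrightarrow> dot (\<lambda>t. A (\<xi> t)) t = A (dot \<xi> t)"
proof -
  have A: "bounded_linear A" by (rule frame_bounded_linear[OF frame_B assms(1)])
  show "(\<lambda>t. A (\<xi> t)) \<in> generators t0 t1"
    using assms by (simp add: generators_def smooth_on_bounded_linear[OF A perfect_J] linear_0)
  show "dot (\<lambda>t. A (\<xi> t)) t = A (dot \<xi> t)" if "t \<in> J"
    by (rule vector_derivative_within[OF within_J[OF that]
          bounded_linear.has_vector_derivative[OF A generator_derivative(1)[OF assms(2) that]]])
qed

text \<open>
Applied to the projections of a splitting: the velocity of a curve in a summand stays in that summand.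
\<close>

lemma dot_fixed:
  fixes A :: "'e \<Rightarrow> 'e"
  assumes "linear A" "\<xi> \<in> generators t0 t1" "\<And>t. t \<in> J \<Longrightarrow> A (\<xi> t) = \<xi> t" "t \<in> J"
  shows "A (dot \<xi> t) = dot \<xi> t"
proof -
  have A: "bounded_linear A" by (rule frame_bounded_linear[OF frame_B assms(1)])
  have "((\<lambda>t. A (\<xi> t)) has_vector_derivative dot \<xi> t) (at t within J)"
    by (rule has_vector_derivative_transform[OF assms(4) _ generator_derivative(1)[OF assms(2,4)]])
      (simp add: assms(3))
  moreover have "((\<lambda>t. A (\<xi> t)) has_vector_derivative A (dot \<xi> t)) (at t within J)"
    by (rule bounded_linear.has_vector_derivative[OF A generator_derivative(1)[OF assms(2,4)]])
  ultimately show ?thesis using vector_derivative_unique_within[OF within_J[OF assms(4)]] by blast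
qed

text \<open>
Tangent variations correspond to the related pairs \<open>(a, b)\<close> by \<open>\<xi> = a + b\<close>, and for such a pair
the first variation is the difference of the two integrals: the part \<open>a\<close> contributes nothing, and in the part
\<open>b\<close> the velocity is \<open>b' = - P'[\<eta>, a] - P'[\<eta>, b]\<close>.
\<close>

lemma vakonomic_condition_iff:
  assumes split: "splitting d d' P P'" and \<eta>: "\<And>t. t \<in> J \<Longrightarrow> \<eta> t \<in> d"
    and nonholonomic: "\<And>\<xi>. \<xi> \<in> generators t0 t1 \<Longrightarrow> (\<And>t. t \<in> J \<Longrightarrow> \<xi> t \<in> d) \<Longrightarrow> dS G t0 t1 \<Lambda> h \<xi> = 0"
  shows "(\<forall>\<xi>\<in>generators t0 t1.
      (\<forall>t\<in>J. variation G t0 t1 h \<xi> t \<in> tangent_vectors_to TG (left_distribution G d)) \<longrightarrow>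
      dS G t0 t1 \<Lambda> h \<xi> = 0) \<longleftrightarrow>
    (\<forall>a b. a \<in> generators t0 t1 \<and> b \<in> generators t0 t1 \<and>
      (\<forall>t\<in>J. a t \<in> d \<and> b t \<in> d' \<and>
        dot b t + P' (lie_bracket G (\<eta> t) (a t)) + P' (lie_bracket G (\<eta> t) (b t)) = 0) \<longrightarrow>
      integral J (\<lambda>t. blinfun_apply (ad_star G (\<eta> t) (dual_map P (p t))) (b t)) =
      integral J (\<lambda>t. blinfun_apply (ad_star G (\<eta> t) (dual_map P' (p t))) (a t)))"
    (is "?vak \<longleftrightarrow> (\<forall>a b. ?rel a b \<longrightarrow> ?lhs b = ?rhs a)")
proof -
  note lin = splitting_linear[OF split] and proj = splitting_projections[OF split]
  have PP: "P v + P' v = v" "P v \<in> d" "P' v \<in> d'" for v using split by (auto simp: splitting_def)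
  have d'_iff: "v \<in> d' \<longleftrightarrow> P' v = v" for v using proj(2)[of v] PP(1)[of v] by (metis add_cancel_left_left)
  have tangent: "(\<forall>t\<in>J. variation G t0 t1 h \<xi> t \<in> tangent_vectors_to TG (left_distribution G d)) \<longleftrightarrow>
      (\<forall>t\<in>J. P' (dot \<xi> t) + P' (lie_bracket G (\<eta> t) (\<xi> t)) = 0)" if "\<xi> \<in> generators t0 t1" for \<xi>
    using tangent_to_distribution_iff[OF interval _ admissible generator_derivative(1)[OF that] split \<eta>]
    by (simp add: proj(1) linear_add[OF lin(2)])
  have dS_pair: "dS G t0 t1 \<Lambda> h (\<lambda>t. a t + b t) = ?lhs b - ?rhs a" if rel: "?rel a b" for a b
  proof -
    have a: "a \<in> generators t0 t1" and b: "b \<in> generators t0 t1" using rel by auto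
    have cont: "continuous_on J (\<lambda>t. blinfun_apply (ad_star G (\<eta> t) (dual_map A (p t))) (u t))"
      if "linear A" "continuous_on J u" for A u
      using that
      by (simp add: ad_star_apply dual_map_apply[OF frame_B] continuous_intros continuous_p
          bounded_linear.continuous_on[OF frame_bounded_linear[OF frame_B that(1)]] continuous_bracket)
    have "dS G t0 t1 \<Lambda> h (\<lambda>t. a t + b t) = dS G t0 t1 \<Lambda> h b"
      using dS_add[OF a b] nonholonomic[OF a] rel by simp
    also have "\<dots> = integral J (\<lambda>t. blinfun_apply (ad_star G (\<eta> t) (dual_map P (p t))) (b t) -
        blinfun_apply (ad_star G (\<eta> t) (dual_map P' (p t))) (a t))"
      unfolding dS_eq[OF b]
    proof (intro integral_cong)
      fix t assume t: "t \<in> J"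
      let ?V = "lie_bracket G (\<eta> t) (a t)" and ?W = "lie_bracket G (\<eta> t) (b t)"
      have "dot b t + P' ?V + P' ?W = 0" using rel t by blast
      moreover have "dot b t + (P ?W + P' ?W) = (dot b t + P' ?V + P' ?W) + (P ?W - P' ?V)"
        by (simp add: algebra_simps)
      ultimately have "dot b t + ?W = P ?W - P' ?V" by (simp add: PP(1))
      then show "blinfun_apply (p t) (dot b t + lie_bracket G (\<eta> t) (b t)) =
          blinfun_apply (ad_star G (\<eta> t) (dual_map P (p t))) (b t) -
          blinfun_apply (ad_star G (\<eta> t) (dual_map P' (p t))) (a t)"
        by (simp add: ad_star_apply dual_map_apply[OF frame_B] lin blinfun.diff_right)
    qed
    also have "\<dots> = ?lhs b - ?rhs a"
      by (intro integral_diff integrable_continuous_interval cont lin generator_derivative(3) a b)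
    finally show ?thesis .
  qed
  show ?thesis
  proof (intro iffI allI impI ballI)
    fix a b assume vak: ?vak and rel: "?rel a b"
    let ?\<xi> = "\<lambda>t. a t + b t"
    have a: "a \<in> generators t0 t1" and b: "b \<in> generators t0 t1" using rel by auto
    have "P' (dot ?\<xi> t) + P' (lie_bracket G (\<eta> t) (?\<xi> t)) = 0" if t: "t \<in> J" for t
    proof -
      have "P (dot a t) = dot a t"
        by (rule dot_fixed[OF lin(1) a _ t]) (use rel proj(1) PP(1) in \<open>metis add.right_neutral\<close>)
      then have "P' (dot a t) = 0" using PP(2) proj(1) by metis
      moreover have "P' (dot b t) = dot b t"
        by (rule dot_fixed[OF lin(2) b _ t]) (use rel d'_iff in blast)
      moreover have "dot ?\<xi> t = dot a t + dot b t"
        by (rule vector_derivative_within[OF within_J[OF t] has_vector_derivative_add])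
          (intro generator_derivative a b t)+
      ultimately show ?thesis
        using rel t by (simp add: linear_add[OF lin(2)] linear_add[OF lie_bracket_linear(1)] add.assoc)
    qed
    then have "dS G t0 t1 \<Lambda> h ?\<xi> = 0"
      using vak tangent[OF generators_add[OF a b]] generators_add[OF a b] by blast
    then show "?lhs b = ?rhs a" using dS_pair[OF rel] by simp
  next
    fix \<xi> assume int: "\<forall>a b. ?rel a b \<longrightarrow> ?lhs b = ?rhs a" and \<xi>: "\<xi> \<in> generators t0 t1"
      and "\<forall>t\<in>J. variation G t0 t1 h \<xi> t \<in> tangent_vectors_to TG (left_distribution G d)"
    then have tan: "P' (dot \<xi> t) + P' (lie_bracket G (\<eta> t) (\<xi> t)) = 0" if "t \<in> J" for t
      using tangent[OF \<xi>] that by blast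
    let ?a = "\<lambda>t. P (\<xi> t)" and ?b = "\<lambda>t. P' (\<xi> t)"
    have "P' (lie_bracket G (\<eta> t) (?a t)) + P' (lie_bracket G (\<eta> t) (?b t)) = P' (lie_bracket G (\<eta> t) (\<xi> t))" for t
      by (metis PP(1) lin(2) linear_add lie_bracket_linear(1))
    then have rel: "?rel ?a ?b"
      using generators_linear[OF lin(1) \<xi>] generators_linear[OF lin(2) \<xi>] PP tan by (simp add: add.assoc)
    then show "dS G t0 t1 \<Lambda> h \<xi> = 0"
      using dS_pair[OF rel] int PP(1) by simp
  qed
qed

end

section \<open>Extremals of left-invariant Lagrangians\<close>

theorem corollary5p6:
  fixes G :: "('h, 'e::real_inner) lie_data"
    and d d' :: "'e set"
    and P P' :: "'e \<Rightarrow> 'e"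
    and L :: "'h \<times> 'e \<Rightarrow> real"
    and t0 t1 :: real
  assumes "lie_group G"
    and "splitting d d' P P'"
    and "smooth_map (prod_manifold G (vec_manifold :: ('e, 'e) charted))
           (vec_manifold :: (real, real) charted) L"
    and "left_invariant G L"
    and "t0 < t1"
  shows
    "(\<forall>g \<zeta>. partial_h G L g \<zeta> = 0) \<and>
     (\<forall>h \<eta>. constrained_curve G d t0 t1 h \<eta> \<longrightarrow>
        \<comment> \<open>(i)\<close>
        (nonholonomic_extremal G d t0 t1 (\<lambda>_. L) h \<eta> \<longrightarrow>
          (unconstrained_extremal G d t0 t1 (\<lambda>_. L) h \<eta> \<longleftrightarrow>
            (\<forall>t\<in>{t0..t1}.
               vector_derivative (\<lambda>s. partial_eta L (h s) (\<eta> s)) (at t within {t0..t1})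
               - ad_star G (\<eta> t) (partial_eta L (h t) (\<eta> t)) \<in> Ann d'))) \<and>
        \<comment> \<open>(ii)\<close>
        (nonholonomic_extremal G d t0 t1 (\<lambda>_. L) h \<eta> \<longrightarrow>
          (vakonomic_extremal G d t0 t1 (\<lambda>_. L) h \<eta> \<longleftrightarrow>
            (\<forall>a b.
               a \<in> generators t0 t1 \<and> b \<in> generators t0 t1 \<and>
               (\<forall>t\<in>{t0..t1}. a t \<in> d \<and> b t \<in> d' \<and>
                  vector_derivative b (at t within {t0..t1})
                  + P' (lie_bracket G (\<eta> t) (a t)) + P' (lie_bracket G (\<eta> t) (b t)) = 0) \<longrightarrow>
               integral {t0..t1}
                 (\<lambda>t. ad_star G (\<eta> t) (dual_map P (partial_eta L (h t) (\<eta> t))) (b t)) =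
               integral {t0..t1}
                 (\<lambda>t. ad_star G (\<eta> t) (dual_map P' (partial_eta L (h t) (\<eta> t))) (a t))))) \<and>
        \<comment> \<open>(iii)\<close>
        (nonholonomic_extremal G d t0 t1 (\<lambda>_. L) h \<eta> \<longleftrightarrow>
          (\<forall>t\<in>{t0..t1}.
             vector_derivative (\<lambda>s. partial_eta L (h s) (\<eta> s)) (at t within {t0..t1})
             - ad_star G (\<eta> t) (partial_eta L (h t) (\<eta> t)) \<in> Ann d)) \<and>
        \<comment> \<open>(iv)\<close>
        (\<forall>\<mu>. vakonomic_extremal_with_multiplier G d P' t0 t1 L \<mu> h \<eta> \<longrightarrow>
          (\<forall>t\<in>{t0..t1}.
             vector_derivative (\<lambda>s. partial_eta L (h s) (\<eta> s) - \<mu> s) (at t within {t0..t1})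
             - ad_star G (\<eta> t) (partial_eta L (h t) (\<eta> t) - \<mu> t) \<in> Ann d')))"
proof (intro conjI allI impI)
  interpret lie_group_charts G by unfold_locales (rule assms(1))
  show "partial_h G L g \<zeta> = 0" for g \<zeta>
    by (rule partial_h_invariant[OF assms(4)])
  fix h \<eta> assume con: "constrained_curve G d t0 t1 h \<eta>"
  let ?J = "{t0..t1}"
  let ?l = "\<lambda>\<zeta>. L (one, \<zeta>)"
  let ?p = "\<lambda>t. partial_eta L (h t) (\<eta> t)"
  have adm: "admissible_curve G t0 t1 h \<eta>" and \<eta>_d: "\<And>t. t \<in> ?J \<Longrightarrow> \<eta> t \<in> d"
    using con by (auto simp: constrained_curve_def)
  have l: "smooth_on UNIV ?l" by (rule smooth_reduced_lagrangian[OF assms(3)])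
  have l': "(?l has_derivative blinfun_apply (?p t)) (at (\<eta> t))" for t
  proof -
    have "(?l has_derivative frechet_derivative ?l (at (\<eta> t))) (at (\<eta> t))"
      by (rule smooth_on_imp_has_derivative[OF l]) auto
    then show ?thesis
      by (simp add: partial_eta_invariant[OF assms(4)] frame_Blinfun_apply[OF frame_B] has_derivative_linear)
  qed
  obtain p' where p': "\<And>t. t \<in> ?J \<Longrightarrow> (?p has_vector_derivative p' t) (at t within ?J)"
    "\<And>v. continuous_on ?J (\<lambda>t. blinfun_apply (p' t) v)"
    using momentum_derivative[OF l perfect_interval[OF assms(5)], of \<eta>] adm
    unfolding admissible_curve_def partial_eta_invariant[OF assms(4)] by blast
  interpret A: left_invariant_action G t0 t1 h \<eta> "\<lambda>_. L" ?p p'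
    by unfold_locales (use assms(4,5) adm l' p' in auto)
  have d: "subspace d" using assms(2) by (simp add: splitting_def)
  have nonhol: "nonholonomic_extremal G d t0 t1 (\<lambda>_. L) h \<eta> \<longleftrightarrow> (\<forall>t\<in>?J. A.EL t \<in> Ann d)"
    using con A.stationary_iff[OF d] by (simp add: nonholonomic_extremal_def)
  then show "nonholonomic_extremal G d t0 t1 (\<lambda>_. L) h \<eta> \<longleftrightarrow>
      (\<forall>t\<in>?J. vector_derivative ?p (at t within ?J) - ad_star G (\<eta> t) (?p t) \<in> Ann d)"
    by (simp add: A.EL_def)
  {
    assume "nonholonomic_extremal G d t0 t1 (\<lambda>_. L) h \<eta>"
    then have "\<forall>t\<in>?J. A.EL t \<in> Ann d' \<longleftrightarrow> A.EL t \<in> Ann UNIV"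
      using nonhol Ann_complement[OF assms(2)] by blast
    then show "unconstrained_extremal G d t0 t1 (\<lambda>_. L) h \<eta> \<longleftrightarrow>
        (\<forall>t\<in>?J. vector_derivative ?p (at t within ?J) - ad_star G (\<eta> t) (?p t) \<in> Ann d')"
      using con A.unconstrained_iff by (simp add: unconstrained_extremal_def A.EL_def)
  }
  {
    assume "nonholonomic_extremal G d t0 t1 (\<lambda>_. L) h \<eta>"
    then show "vakonomic_extremal G d t0 t1 (\<lambda>_. L) h \<eta> \<longleftrightarrow>
      (\<forall>a b. a \<in> generators t0 t1 \<and> b \<in> generators t0 t1 \<and>
        (\<forall>t\<in>?J. a t \<in> d \<and> b t \<in> d' \<and> vector_derivative b (at t within ?J)
          + P' (lie_bracket G (\<eta> t) (a t)) + P' (lie_bracket G (\<eta> t) (b t)) = 0) \<longrightarrow>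
        integral ?J (\<lambda>t. ad_star G (\<eta> t) (dual_map P (?p t)) (b t)) =
        integral ?J (\<lambda>t. ad_star G (\<eta> t) (dual_map P' (?p t)) (a t)))"
      using A.vakonomic_condition_iff[OF assms(2) \<eta>_d] con
      by (simp add: vakonomic_extremal_def nonholonomic_extremal_def)
  }
  fix \<mu> assume mult: "vakonomic_extremal_with_multiplier G d P' t0 t1 L \<mu> h \<eta>"
  let ?\<Lambda> = "\<lambda>t (g, \<zeta>). L (g, \<zeta>) - blinfun_apply (\<mu> t) (P' \<zeta>)"
  have \<mu>: "smooth_on ?J \<mu>" "\<And>t. t \<in> ?J \<Longrightarrow> \<mu> t = dual_map P' (\<mu> t)"
    and ext: "unconstrained_extremal G d t0 t1 ?\<Lambda> h \<eta>"
    using mult by (auto simp: vakonomic_extremal_with_multiplier_def)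
  note \<mu>' = smooth_on_imp_C1[OF perfect_interval[OF assms(5)] \<mu>(1)]
  interpret M: left_invariant_action G t0 t1 h \<eta> ?\<Lambda> "\<lambda>t. ?p t - \<mu> t"
    "\<lambda>t. p' t - vector_derivative \<mu> (at t within ?J)"
  proof unfold_locales
    fix t assume t: "t \<in> ?J"
    show "left_invariant G (?\<Lambda> t)" using assms(4) by (simp add: left_invariant_def)
    have "blinfun_apply (\<mu> t) (P' v) = blinfun_apply (\<mu> t) v" for v
      using dual_map_apply[OF frame_B splitting_linear(2)[OF assms(2)], of "\<mu> t" v] \<mu>(2)[OF t] by simp
    then have eq: "blinfun_apply (?p t - \<mu> t) = (\<lambda>v. blinfun_apply (?p t) v - blinfun_apply (\<mu> t) (P' v))"
      by (simp add: fun_eq_iff blinfun.diff_left)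
    have "bounded_linear P'"
      by (rule frame_bounded_linear[OF frame_B splitting_linear(2)[OF assms(2)]])
    then show "((\<lambda>\<zeta>. ?\<Lambda> t (one, \<zeta>)) has_derivative blinfun_apply (?p t - \<mu> t)) (at (\<eta> t))"
      unfolding eq prod.case
      by (intro has_derivative_diff l' bounded_linear_imp_has_derivative
          bounded_linear_compose[OF blinfun.bounded_linear_right])
    show "((\<lambda>t. ?p t - \<mu> t) has_vector_derivative p' t - vector_derivative \<mu> (at t within ?J)) (at t within ?J)"
      by (intro has_vector_derivative_diff p' \<mu>' t)
  next
    show "continuous_on ?J (\<lambda>t. blinfun_apply (p' t - vector_derivative \<mu> (at t within ?J)) v)" for v
      unfolding blinfun.diff_left by (intro continuous_intros p' \<mu>')
  qed (rule assms(5) adm)+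
  have "\<forall>t\<in>?J. M.EL t \<in> Ann UNIV"
    using ext M.unconstrained_iff by (simp add: unconstrained_extremal_def)
  then show "\<forall>t\<in>?J. vector_derivative (\<lambda>s. ?p s - \<mu> s) (at t within ?J)
      - ad_star G (\<eta> t) (?p t - \<mu> t) \<in> Ann d'"
    by (auto simp: M.EL_def Ann_def)
qed

end
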